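(* Suppose that for some $\sigma$-field $\mathcal{X}\subset\mathcal{B}$ the following hold. 1. $\mathcal{X}\subset T^{-1}\mathcal{X}$. 2. The following martingales converge uniformly: $$\mathop{\mathrm{ess\,sup}}_{u\in\mathbb{U}_0}\big|\mathbf{E}[\ell_0(u)|\mathcal{Y}_{-\infty,0}\vee T^{-n}\mathcal{X}]-\ell_0(u)\big|\xrightarrow{n\to\infty}0\quad\text{in }L^1,$$ $$\mathop{\mathrm{ess\,sup}}_{u\in\mathbb{U}_0}\Big|\mathbf{E}[\ell_0(u)|\mathcal{Y}_{-\infty,0}\vee T^{n}\mathcal{X}]-\mathbf{E}\Big[\ell_0(u)\Big|\bigcap_{k=1}^\infty(\mathcal{Y}_{-\infty,0}\vee T^{k}\mathcal{X})\Big]\Big|\xrightarrow{n\to\infty}0\quad\text{in }L^1,$$ $$\mathop{\mathrm{ess\,sup}}_{u\in\mathbb{U}_{-n,0}}\big|\mathbf{E}[\ell_0(u)|\mathcal{Y}_{-n,0}]-\mathbf{E}[\ell_0(u)|\mathcal{Y}_{-\infty,0}]\big|\xrightarrow{n\to\infty}0\quad\text{a.s.}$$ 3. The remote past does not affect the present: $$\mathbf{E}[\ell_0(u)|\mathcal{Y}_{-\infty,0}]=\mathbf{E}\Big[\ell_0(u)\Big|\bigcap_{k=1}^\infty(\mathcal{Y}_{-\infty,0}\vee T^{k}\mathcal{X})\Big]\quad\text{for all }u\in\mathbb{U}_0.$$ Then the mean-optimal strategy $\mathbf{\tilde u}$ satisfies $L_N(\mathbf{\tilde u})\to L^\star$ a.s.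 as $N\to\infty$, where $L^\star=\mathbf{E}\big[\mathop{\mathrm{ess\,inf}}_{u\in\mathbb{U}_0}\mathbf{E}[\ell_0(u)|\mathcal{Y}_{-\infty,0}]\big]$. In particular, $\mathbf{\tilde u}$ is pathwise optimal: $\liminf_{N\to\infty}\{L_N(\mathbf{u})-L_N(\mathbf{\tilde u})\}\ge0$ a.s. for every admissible strategy $\mathbf{u}$.
   Context: Setting: $(\Omega,\mathcal{B},\mathbf{P})$ is a probability space, $\mathcal{Y}\subseteq\mathcal{B}$ a sub-$\sigma$-field, $T:\Omega\to\Omega$ an invertible (bimeasurable) measure-preserving ergodic transformation, $(U,\mathcal{U})$ a measurable space of decisions. For a $\sigma$-field $\mathcal{A}$ and $k\in\mathbb{Z}$, $T^k\mathcal{A}=\{T^kA:A\in\mathcal{A}\}$. For $-\infty\le m\le n\le\infty$, $\mathcal{Y}_{m,n}=\bigvee_{k=m}^n T^{-k}\mathcal{Y}$. For $m\le n$, $\mathbb{U}_{m,n}$ is the set of $\mathcal{Y}_{m,n}$-measurable maps $u:\Omega\to U$, and $\mathbb{U}_n=\bigcup_{-\infty<m\le n}\mathbb{U}_{m,n}$. Loss: $\ell:U\times\Omega\to\mathbb{R}$ is measurable and $|\ell(u,\omega)|\le\Lambda(\omega)$ for all $(u,\omega)$ with $\Lambda\in L^1(\mathbf{P})$. For $n\in\mathbb{Z}$, $\ell_n(u)(\omega)=\ell(u,T^n\omega)$; for a random decision $u:\Omega\to U$, $\ell_n(u)(\omega)=\ell(u(\omega),T^n\omega)$. A strategy $\mathbf{u}=(u_k)_{k\ge1}$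 is admissible if $u_k\in\mathbb{U}_{0,k}$ for every $k\ge 1$. Its time-average loss over horizon $N$ is $L_N(\mathbf{u})=\frac1N\sum_{k=1}^N\ell_k(u_k)$. Mean-optimal strategy: $\mathbf{\tilde u}=(\tilde u_k)_{k\ge1}$ denotes an (arbitrary, fixed) admissible strategy such that for every $k\ge1$, $\mathbf{E}[\ell_k(\tilde u_k)|\mathcal{Y}_{0,k}]\le \mathop{\mathrm{ess\,inf}}_{u\in\mathbb{U}_{0,k}}\mathbf{E}[\ell_k(u)|\mathcal{Y}_{0,k}]+k^{-1}$ a.s. (such a strategy always exists). *)

theory Defs
  imports "HOL-Probability.Probability"
begin

text \<open>
  Sigma-fields on the sample space \<open>space M\<close> are represented by their systems of sets; \<open>\<B>\<close> is
  \<open>sets M\<close>. The decision space \<open>(U, \<U>)\<close> is \<open>(space D, sets D)\<close>; the measure carried by \<open>D\<close> is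
  irrelevant.
\<close>

definition sub_sigma_field :: "'a measure \<Rightarrow> 'a set set \<Rightarrow> bool" where
  "sub_sigma_field M \<A> \<longleftrightarrow> sigma_algebra (space M) \<A> \<and> \<A> \<subseteq> sets M"

definition invertible_measure_preserving :: "'a measure \<Rightarrow> ('a \<Rightarrow> 'a) \<Rightarrow> bool" where
  "invertible_measure_preserving M T \<longleftrightarrow>
     bij_betw T (space M) (space M) \<and>
     T \<in> measurable M M \<and> inv_into (space M) T \<in> measurable M M \<and>
     (\<forall>A\<in>sets M. emeasure M (T -` A \<inter> space M) = emeasure M A)"

definition ergodic :: "'a measure \<Rightarrow> ('a \<Rightarrow> 'a) \<Rightarrow> bool" where
  "ergodic M T \<longleftrightarrow>
     (\<forall>A\<in>sets M. T -` A \<inter> space M = A \<longrightarrow> emeasure M A = 0 \<or> emeasure M (space M - A) = 0)"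

text \<open>The integer power \<open>T\<^sup>k\<close>; meaningful on \<open>space M\<close> only.\<close>

definition iter :: "'a measure \<Rightarrow> ('a \<Rightarrow> 'a) \<Rightarrow> int \<Rightarrow> 'a \<Rightarrow> 'a" where
  "iter M T k = (if 0 \<le> k then T ^^ nat k else inv_into (space M) T ^^ nat (- k))"

definition shift_field :: "'a measure \<Rightarrow> ('a \<Rightarrow> 'a) \<Rightarrow> int \<Rightarrow> 'a set set \<Rightarrow> 'a set set" where
  "shift_field M T k \<A> = (\<lambda>A. iter M T k ` A) ` \<A>"

definition join_field :: "'a measure \<Rightarrow> 'a set set \<Rightarrow> 'a set set \<Rightarrow> 'a set set" where
  "join_field M \<A> \<C> = sigma_sets (space M) (\<A> \<union> \<C>)"

text \<open>\<open>\<Y>\<^bsub>m,n\<^esub>\<close> is \<open>obs_field M T \<Y> {m..n}\<close>, and \<open>\<Y>\<^bsub>-\<infinity>,n\<^esub>\<close> is \<open>obs_field M T \<Y> {..n}\<close>.\<close>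

definition obs_field :: "'a measure \<Rightarrow> ('a \<Rightarrow> 'a) \<Rightarrow> 'a set set \<Rightarrow> int set \<Rightarrow> 'a set set" where
  "obs_field M T \<Y> I = sigma_sets (space M) (\<Union>k\<in>I. shift_field M T (- k) \<Y>)"

definition decisions ::
  "'a measure \<Rightarrow> ('a \<Rightarrow> 'a) \<Rightarrow> 'a set set \<Rightarrow> 'u measure \<Rightarrow> int \<Rightarrow> int \<Rightarrow> ('a \<Rightarrow> 'u) set" where
  "decisions M T \<Y> D m n = measurable (sigma (space M) (obs_field M T \<Y> {m..n})) D"

definition decisions_upto ::
  "'a measure \<Rightarrow> ('a \<Rightarrow> 'a) \<Rightarrow> 'a set set \<Rightarrow> 'u measure \<Rightarrow> int \<Rightarrow> ('a \<Rightarrow> 'u) set" where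
  "decisions_upto M T \<Y> D n = (\<Union>m\<in>{..n}. decisions M T \<Y> D m n)"

definition cond_exp :: "'a measure \<Rightarrow> 'a set set \<Rightarrow> ('a \<Rightarrow> real) \<Rightarrow> 'a \<Rightarrow> real" where
  "cond_exp M \<A> f = real_cond_exp M (sigma (space M) \<A>) f"

text \<open>
  Essential supremum and infimum of a possibly uncountable family of random variables, as extended
  real random variables. They always exist and are unique up to null sets; \<open>ess_sup\<close> and \<open>ess_inf\<close>
  pick some version. (The library's \<open>esssup\<close> is the number associated with a single function.)
\<close>

definition is_ess_sup :: "'a measure \<Rightarrow> 'i set \<Rightarrow> ('i \<Rightarrow> 'a \<Rightarrow> real) \<Rightarrow> ('a \<Rightarrow> ereal) \<Rightarrow> bool" where
  "is_ess_sup M I f Z \<longleftrightarrow>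
     Z \<in> borel_measurable M \<and> (\<forall>i\<in>I. AE \<omega> in M. ereal (f i \<omega>) \<le> Z \<omega>) \<and>
     (\<forall>Z'\<in>borel_measurable M.
        (\<forall>i\<in>I. AE \<omega> in M. ereal (f i \<omega>) \<le> Z' \<omega>) \<longrightarrow> (AE \<omega> in M. Z \<omega> \<le> Z' \<omega>))"

definition is_ess_inf :: "'a measure \<Rightarrow> 'i set \<Rightarrow> ('i \<Rightarrow> 'a \<Rightarrow> real) \<Rightarrow> ('a \<Rightarrow> ereal) \<Rightarrow> bool" where
  "is_ess_inf M I f Z \<longleftrightarrow>
     Z \<in> borel_measurable M \<and> (\<forall>i\<in>I. AE \<omega> in M. Z \<omega> \<le> ereal (f i \<omega>)) \<and>
     (\<forall>Z'\<in>borel_measurable M.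
        (\<forall>i\<in>I. AE \<omega> in M. Z' \<omega> \<le> ereal (f i \<omega>)) \<longrightarrow> (AE \<omega> in M. Z' \<omega> \<le> Z \<omega>))"

definition ess_sup :: "'a measure \<Rightarrow> 'i set \<Rightarrow> ('i \<Rightarrow> 'a \<Rightarrow> real) \<Rightarrow> 'a \<Rightarrow> ereal" where
  "ess_sup M I f = (SOME Z. is_ess_sup M I f Z)"

definition ess_inf :: "'a measure \<Rightarrow> 'i set \<Rightarrow> ('i \<Rightarrow> 'a \<Rightarrow> real) \<Rightarrow> 'a \<Rightarrow> ereal" where
  "ess_inf M I f = (SOME Z. is_ess_inf M I f Z)"

definition L1_tendsto_zero :: "'a measure \<Rightarrow> (nat \<Rightarrow> 'a \<Rightarrow> ereal) \<Rightarrow> bool" where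
  "L1_tendsto_zero M Z \<longleftrightarrow> (\<lambda>n. \<integral>\<^sup>+ \<omega>. e2ennreal \<bar>Z n \<omega>\<bar> \<partial>M) \<longlonglongrightarrow> 0"

text \<open>The loss \<open>\<ell>\<^sub>n(u)\<close> of a random decision \<open>u\<close> at time \<open>n\<close>.\<close>

definition loss_at ::
  "'a measure \<Rightarrow> ('a \<Rightarrow> 'a) \<Rightarrow> ('u \<Rightarrow> 'a \<Rightarrow> real) \<Rightarrow> int \<Rightarrow> ('a \<Rightarrow> 'u) \<Rightarrow> 'a \<Rightarrow> real" where
  "loss_at M T l n u \<omega> = l (u \<omega>) (iter M T n \<omega>)"

text \<open>Strategies are sequences indexed by \<open>nat\<close> whose entry at \<open>0\<close> is irrelevant.\<close>

definition admissible ::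
  "'a measure \<Rightarrow> ('a \<Rightarrow> 'a) \<Rightarrow> 'a set set \<Rightarrow> 'u measure \<Rightarrow> (nat \<Rightarrow> 'a \<Rightarrow> 'u) \<Rightarrow> bool" where
  "admissible M T \<Y> D u \<longleftrightarrow> (\<forall>k\<ge>1. u k \<in> decisions M T \<Y> D 0 (int k))"

definition avg_loss ::
  "'a measure \<Rightarrow> ('a \<Rightarrow> 'a) \<Rightarrow> ('u \<Rightarrow> 'a \<Rightarrow> real) \<Rightarrow> nat \<Rightarrow> (nat \<Rightarrow> 'a \<Rightarrow> 'u) \<Rightarrow> 'a \<Rightarrow> real" where
  "avg_loss M T l N u \<omega> = (1 / real N) * (\<Sum>k=1..N. loss_at M T l (int k) (u k) \<omega>)"

definition mean_optimal ::
  "'a measure \<Rightarrow> ('a \<Rightarrow> 'a) \<Rightarrow> 'a set set \<Rightarrow> 'u measure \<Rightarrow> ('u \<Rightarrow> 'a \<Rightarrow> real) \<Rightarrow>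
     (nat \<Rightarrow> 'a \<Rightarrow> 'u) \<Rightarrow> bool" where
  "mean_optimal M T \<Y> D l u \<longleftrightarrow>
     admissible M T \<Y> D u \<and>
     (\<forall>k\<ge>1. AE \<omega> in M.
        ereal (cond_exp M (obs_field M T \<Y> {0..int k}) (loss_at M T l (int k) (u k)) \<omega>)
        \<le> ess_inf M (decisions M T \<Y> D 0 (int k))
             (\<lambda>v. cond_exp M (obs_field M T \<Y> {0..int k}) (loss_at M T l (int k) v)) \<omega>
           + ereal (1 / real k))"

text \<open>
  The essential infimum below is almost surely finite and integrable, as \<open>l\<close> is dominated by an
  integrable function, so that \<open>real_of_ereal\<close> only changes it on a null set.
\<close>

definition optimal_loss ::
  "'a measure \<Rightarrow> ('a \<Rightarrow> 'a) \<Rightarrow> 'a set set \<Rightarrow> 'u measure \<Rightarrow> ('u \<Rightarrow> 'a \<Rightarrow> real) \<Rightarrow> real" where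
  "optimal_loss M T \<Y> D l =
     (\<integral>\<omega>. real_of_ereal (ess_inf M (decisions_upto M T \<Y> D 0)
        (\<lambda>u. cond_exp M (obs_field M T \<Y> {..0}) (loss_at M T l 0 u)) \<omega>) \<partial>M)"

end

theory Submission
  imports Defs "HOL-Library.Discrete_Functions"
begin

text \<open>
  Recentre the decisions to \<open>v\<^sub>k = u\<^sub>k \<circ> T\<^sup>-\<^sup>k\<close>, so that the loss at time \<open>k\<close> is \<open>\<ell>\<^sub>0(v\<^sub>k) \<circ> T\<^sup>k\<close>, and let
  \<open>H\<^sub>j = \<Y>\<^bsub>-\<infinity>,0\<^esub> \<or> T\<^sup>j\<X>\<close>, which decreases in \<open>j\<close>. For fixed \<open>j\<close> the variables
  \<open>(E[\<ell>\<^sub>0(v\<^sub>k)|H\<^sub>j] - E[\<ell>\<^sub>0(v\<^sub>k)|H\<^sub>j\<^sub>+\<^sub>1]) \<circ> T\<^sup>k\<close> are martingale differences and obey a strong law. Telescoping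
  over \<open>-n \<le> j < n\<close> and bounding the two ends through the uniform convergence in \<open>L\<^sup>1\<close> and Birkhoff's
  theorem replaces \<open>\<ell>\<^sub>0(v\<^sub>k)\<close> by \<open>E[\<ell>\<^sub>0(v\<^sub>k)|\<Y>\<^bsub>-\<infinity>,0\<^esub>]\<close> in the time average of every admissible strategy.
  The latter dominates the essential infimum, whose average converges to \<open>L\<^sup>\<star>\<close>. For the mean-optimal
  strategy the excess over the essential infimum tends to \<open>0\<close> almost surely, and it is dominated by
  \<open>2 E[\<Lambda>|\<Y>\<^bsub>-\<infinity>,0\<^esub>]\<close>, so Maker's ergodic theorem applies to it. (The conditional expectations given the
  finite pasts \<open>\<Y>\<^bsub>-k,0\<^esub>\<close> need not have an integrable supremum in \<open>k\<close>.)
\<close>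

section \<open>Birkhoff's and Maker's ergodic theorems\<close>

locale ergodic_map = prob_space M for M :: "'a measure" +
  fixes T :: "'a \<Rightarrow> 'a"
  assumes T_measurable [measurable]: "T \<in> measurable M M"
    and distr_T: "distr M M T = M"
    and ergodic: "ergodic M T"
begin

text \<open>The \<open>k\<close>-th function is read at the \<open>k\<close>-th point of the orbit,
  so that one notion serves both for Birkhoff averages (\<open>a\<close> constant in
  \<open>k\<close>) and for sequences of functions. At \<open>N = 0\<close> the value is
  \<open>0\<close>.\<close>

definition cesaro :: "(nat \<Rightarrow> 'a \<Rightarrow> real) \<Rightarrow> nat \<Rightarrow> 'a \<Rightarrow> real" where
  "cesaro a N x = (\<Sum>k=1..N. a k ((T ^^ k) x)) / real N"

lemma funpow_measurable [measurable]: "T ^^ n \<in> measurable M M"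
  by (rule measurable_compose_n[OF T_measurable])

lemma distr_funpow: "distr M M (T ^^ n) = M"
proof (induction n)
  case (Suc n)
  have "distr M M (T ^^ Suc n) = distr (distr M M (T ^^ n)) M T"
    by (subst distr_distr) auto
  then show ?case by (simp only: Suc distr_T)
qed (auto simp: id_def distr_id)

lemma AE_funpow:
  assumes "AE x in M. P x"
  shows "AE x in M. P ((T ^^ n) x)"
proof (rule AE_distrD[OF funpow_measurable])
  show "AE x in distr M M (T ^^ n). P x" unfolding distr_funpow by fact
qed

lemma integrable_funpow:
  fixes f :: "'a \<Rightarrow> real"
  assumes "integrable M f"
  shows "integrable M (\<lambda>x. f ((T ^^ n) x))"
  using assms integrable_distr[OF funpow_measurable, of n f] by (simp add: distr_funpow)

lemma integral_funpow:
  fixes f :: "'a \<Rightarrow> real"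
  assumes "f \<in> borel_measurable M"
  shows "(\<integral>x. f ((T ^^ n) x) \<partial>M) = (\<integral>x. f x \<partial>M)"
  using integral_distr[OF funpow_measurable assms, of n] by (simp add: distr_funpow)

text \<open>The maximum of \<open>0\<close> and the sums of \<open>f\<close> over the first
  \<open>1, ..., n\<close> orbit points. The recursion peels off the first point and so relates the
  value at \<open>x\<close> to that at \<open>T x\<close>.\<close>

primrec max_sum :: "('a \<Rightarrow> real) \<Rightarrow> nat \<Rightarrow> 'a \<Rightarrow> real" where
  "max_sum f 0 x = 0"
| "max_sum f (Suc n) x = max 0 (f x + max_sum f n (T x))"

lemma max_sum_nonneg: "0 \<le> max_sum f n x"
  by (cases n) auto

lemma max_sum_mono_Suc: "max_sum f n x \<le> max_sum f (Suc n) x"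
proof (induction n arbitrary: x)
  case (Suc n)
  have "max_sum f n (T x) \<le> max_sum f (Suc n) (T x)" by (rule Suc)
  then show ?case unfolding max_sum.simps(2)[of f _ x] by linarith
qed auto

lemma max_sum_mono: "m \<le> n \<Longrightarrow> max_sum f m x \<le> max_sum f n x"
  by (rule lift_Suc_mono_le[of "\<lambda>n. max_sum f n x"]) (rule max_sum_mono_Suc)

lemma sum_le_max_sum: "(\<Sum>k<n. f ((T ^^ k) x)) \<le> max_sum f n x"
proof (induction n arbitrary: x)
  case (Suc n)
  have "(\<Sum>k<Suc n. f ((T ^^ k) x)) = f x + (\<Sum>k<n. f ((T ^^ k) (T x)))"
    by (simp only: sum.lessThan_Suc_shift funpow_Suc_right o_apply) simp
  also have "\<dots> \<le> f x + max_sum f n (T x)" using Suc[of "T x"] by simp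
  finally show ?case by simp
qed auto

lemma integrable_max_sum: "integrable M f \<Longrightarrow> integrable M (max_sum f n)"
proof (induction n)
  case (Suc n)
  have "integrable M (\<lambda>x. max_sum f n (T x))"
    using integrable_funpow[OF Suc.IH[OF Suc.prems], of 1] by simp
  then show ?case using Suc.prems by simp
qed (simp add: fun_eq_iff[symmetric] cong: Bochner_Integration.integrable_cong)

text \<open>On the invariant set where the maximal sums are unbounded,
  \<open>max_sum f (Suc n) - max_sum f n \<circ> T\<close> tends to \<open>f\<close>, while its integral stays nonnegative.\<close>

lemma bdd_above_sums_if_integral_neg:
  fixes f :: "'a \<Rightarrow> real"
  assumes f: "integrable M f" and neg: "(\<integral>x. f x \<partial>M) < 0"
  shows "AE x in M. \<exists>C. \<forall>n. (\<Sum>k<n. f ((T ^^ k) x)) \<le> C"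
proof -
  note [measurable] = integrable_max_sum[OF f, THEN borel_measurable_integrable]
    f[THEN borel_measurable_integrable]
  define A where "A = {x \<in> space M. \<forall>c::nat. \<exists>n. max_sum f n x > real c}"
  have A [measurable]: "A \<in> sets M" unfolding A_def by measurable
  \<comment> \<open>One step of the recursion changes the value by at most
    \<open>\<bar>f x\<bar>\<close>, hence the slack
    \<open>nat \<lceil>\<bar>f x\<bar>\<rceil>\<close> in both directions.\<close>
  have AT: "T x \<in> A \<longleftrightarrow> x \<in> A" if x: "x \<in> space M" for x
  proof
    assume a: "T x \<in> A"
    show "x \<in> A"
      unfolding A_def
    proof (safe, fact)
      fix c :: nat
      obtain n where "max_sum f n (T x) > real (c + nat \<lceil>\<bar>f x\<bar>\<rceil>)"
        using a unfolding A_def by blast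
      then have "max_sum f (Suc n) x > real c" by (simp, linarith)
      then show "\<exists>n. real c < max_sum f n x" by blast
    qed
  next
    assume a: "x \<in> A"
    show "T x \<in> A"
      unfolding A_def
    proof safe
      show "T x \<in> space M" using x by (rule measurable_space[OF T_measurable])
      fix c :: nat
      obtain n where n: "max_sum f n x > real (c + nat \<lceil>\<bar>f x\<bar>\<rceil>)"
        using a unfolding A_def by blast
      then have "n \<noteq> 0"
        by (metis max_sum.simps(1) not_less of_nat_0_le_iff)
      then obtain m where "n = Suc m" by (cases n) auto
      then have "f x + max_sum f m (T x) > real (c + nat \<lceil>\<bar>f x\<bar>\<rceil>)"
        using n of_nat_0_le_iff[of "c + nat \<lceil>\<bar>f x\<bar>\<rceil>", where 'a = real] by (simp only: max_sum.simps max_def split: if_splits)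
      then have "max_sum f m (T x) > real c" by (simp, linarith)
      then show "\<exists>n. real c < max_sum f n (T x)" by blast
    qed
  qed
  have inv: "T -` A \<inter> space M = A"
    using AT A_def by auto
  have lim: "(\<lambda>n. \<integral>x. indicator A x * (max_sum f (Suc n) x - max_sum f n (T x)) \<partial>M)
      \<longlonglongrightarrow> (\<integral>x. indicator A x * f x \<partial>M)"
  proof (rule integral_dominated_convergence)
    show "integrable M (\<lambda>x. \<bar>f x\<bar>)" using f by simp
    show "AE x in M. norm (indicator A x * (max_sum f (Suc n) x - max_sum f n (T x))) \<le> \<bar>f x\<bar>" for n
    proof (rule AE_I2)
      fix x
      show "norm (indicator A x * (max_sum f (Suc n) x - max_sum f n (T x))) \<le> \<bar>f x\<bar>"
        using max_sum_nonneg[of f n "T x"] by (cases "x \<in> A") auto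
    qed
    show "AE x in M. (\<lambda>n. indicator A x * (max_sum f (Suc n) x - max_sum f n (T x)))
        \<longlonglongrightarrow> indicator A x * f x"
    proof (rule AE_I2, cases)
      fix x assume x: "x \<in> space M" "x \<in> A"
      then have "T x \<in> A" using AT by simp
      then obtain n where n: "max_sum f n (T x) > real (nat \<lceil>\<bar>f x\<bar>\<rceil>)"
        unfolding A_def by blast
      \<comment> \<open>Once the value at \<open>T x\<close> exceeds \<open>\<bar>f x\<bar>\<close>,
        the maximum with \<open>0\<close> is inactive and the difference is exactly
        \<open>f x\<close>.\<close>
      have "max_sum f (Suc m) x - max_sum f m (T x) = f x" if "m \<ge> n" for m
        using max_sum_mono[OF that, of f "T x"] n by (auto simp: max_def) linarith+
      then show "(\<lambda>n. indicator A x * (max_sum f (Suc n) x - max_sum f n (T x)))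
        \<longlonglongrightarrow> indicator A x * f x"
        by (intro tendsto_eventually eventually_sequentiallyI[of n]) simp
    qed simp
  qed simp_all
  have int: "integrable M (\<lambda>x. indicator A x * g x)" if "integrable M g" for g :: "'a \<Rightarrow> real"
    using integrable_mult_indicator[OF A that] by simp
  have "0 \<le> (\<integral>x. indicator A x * (max_sum f (Suc n) x - max_sum f n (T x)) \<partial>M)" for n
  proof -
    have i: "integrable M (\<lambda>x. indicator A x * max_sum f n (T x))"
      by (intro int) (use integrable_funpow[OF integrable_max_sum[OF f, of n], of 1] in simp)
    \<comment> \<open>Invariance of \<open>A\<close> lets the indicator move along with
      \<open>T\<close>; measure preservation then removes \<open>T\<close>, and monotonicity in
      \<open>n\<close> finishes.\<close>
    have "(\<integral>x. indicator A x * max_sum f n (T x) \<partial>M) = (\<integral>x. indicator A (T x) * max_sum f n (T x) \<partial>M)"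
      by (rule Bochner_Integration.integral_cong) (auto simp: AT indicator_def)
    also have "\<dots> = (\<integral>x. indicator A x * max_sum f n x \<partial>M)"
      using integral_funpow[of "\<lambda>x. indicator A x * max_sum f n x" 1] by simp
    also have "\<dots> \<le> (\<integral>x. indicator A x * max_sum f (Suc n) x \<partial>M)"
      by (intro integral_mono int integrable_max_sum f mult_left_mono max_sum_mono_Suc) simp
    finally show ?thesis
      using i int[OF integrable_max_sum[OF f, of "Suc n"]]
      by (simp add: right_diff_distrib del: max_sum.simps)
  qed
  then have ge: "0 \<le> (\<integral>x. indicator A x * f x \<partial>M)"
    by (intro LIMSEQ_le_const[OF lim]) auto
  \<comment> \<open>If \<open>A\<close> had full measure, the nonnegative limit would be the
    integral of \<open>f\<close>, which is negative. Ergodicity then leaves only that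
    \<open>A\<close> is null.\<close>
  have "emeasure M (space M - A) \<noteq> 0"
  proof
    assume "emeasure M (space M - A) = 0"
    then have "AE x in M. x \<in> A" by (intro AE_I[of _ _ "space M - A"]) auto
    then have "(\<integral>x. indicator A x * f x \<partial>M) = (\<integral>x. f x \<partial>M)"
      by (intro integral_cong_AE) auto
    then show False using ge neg by simp
  qed
  then have "emeasure M A = 0"
    using ergodic inv A unfolding ergodic_def by blast
  then have "AE x in M. x \<notin> A" using A by (intro AE_not_in) auto
  then show ?thesis
    using AE_space
  proof eventually_elim
    case (elim x)
    then obtain c :: nat where "\<forall>n. max_sum f n x \<le> real c"
      unfolding A_def by (auto simp: not_less)
    then show ?case using sum_le_max_sum order_trans by blast
  qed
qed

text \<open>For \<open>d\<close> strictly between the integral and \<open>c\<close>, the sums of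
  \<open>f - d\<close> are almost surely bounded above, so the averages of \<open>f\<close> exceed
  \<open>d\<close> by at most a constant over \<open>N\<close>.\<close>

lemma cesaro_eventually_le:
  fixes f :: "'a \<Rightarrow> real"
  assumes f: "integrable M f" and lt: "(\<integral>x. f x \<partial>M) < c"
  shows "AE x in M. eventually (\<lambda>N. cesaro (\<lambda>_. f) N x < c) sequentially"
proof -
  obtain d where d: "(\<integral>x. f x \<partial>M) < d" "d < c" using lt dense by blast
  \<comment> \<open>Composing with \<open>T\<close> turns the sums over
    \<open>k = 0, ..., N - 1\<close> of the preceding lemma into the sums over
    \<open>k = 1, ..., N\<close> of \<open>cesaro\<close>.\<close>
  define g where "g = (\<lambda>x. f (T x) - d)"
  have fT: "integrable M (\<lambda>x. f (T x))" "(\<integral>x. f (T x) \<partial>M) = (\<integral>x. f x \<partial>M)"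
    using integrable_funpow[OF f, of 1] integral_funpow[of f 1] f by auto
  have "integrable M g" "(\<integral>x. g x \<partial>M) < 0"
    unfolding g_def using fT d by (auto simp: prob_space)
  from bdd_above_sums_if_integral_neg[OF this] show ?thesis
  proof eventually_elim
    case (elim x)
    then obtain C where C: "\<And>n. (\<Sum>k<n. g ((T ^^ k) x)) \<le> C" by blast
    have sum: "(\<Sum>k<N. g ((T ^^ k) x)) = (\<Sum>k=1..N. f ((T ^^ k) x)) - real N * d" for N
    proof -
      have "(\<Sum>k=1..N. f ((T ^^ k) x)) = (\<Sum>k<N. f ((T ^^ Suc k) x))"
        by (rule sum.reindex_bij_witness[of _ Suc "\<lambda>k. k - 1"]) auto
      then show ?thesis by (simp add: g_def sum_subtractf)
    qed
    have "eventually (\<lambda>N. real N > \<bar>C\<bar> / (c - d)) sequentially"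
      by (rule filterlim_real_sequentially[THEN filterlim_at_top_dense[THEN iffD1], rule_format])
    then show ?case
      using eventually_gt_at_top[of 0]
    proof eventually_elim
      case (elim N)
      have "\<bar>C\<bar> < real N * (c - d)" using elim d by (simp add: field_simps)
      then have "(\<Sum>k=1..N. f ((T ^^ k) x)) < real N * c"
        using C[of N] sum[of N] by (simp add: algebra_simps)
      then show ?case using elim by (simp add: cesaro_def field_simps)
    qed
  qed
qed

section \<open>Comparison of averages; the theorems of Birkhoff and Maker\<close>

lemma cesaro_uminus: "cesaro (\<lambda>k x. - a k x) N x = - cesaro a N x"
  by (simp add: cesaro_def sum_negf)

lemma cesaro_add: "cesaro (\<lambda>k x. a k x + b k x) N x = cesaro a N x + cesaro b N x"
  by (simp add: cesaro_def sum.distrib add_divide_distrib)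

lemma cesaro_diff: "cesaro (\<lambda>k x. a k x - b k x) N x = cesaro a N x - cesaro b N x"
  by (simp add: cesaro_def sum_subtractf diff_divide_distrib)

lemma cesaro_mono:
  "(\<And>k. k \<ge> 1 \<Longrightarrow> a k ((T ^^ k) x) \<le> b k ((T ^^ k) x)) \<Longrightarrow> cesaro a N x \<le> cesaro b N x"
  unfolding cesaro_def by (intro divide_right_mono sum_mono) auto

text \<open>The exceptional null set may depend on \<open>e\<close>; it suffices to treat the
  countably many values \<open>1 / real (Suc m)\<close>.\<close>

lemma AE_tendsto_realI:
  fixes X :: "nat \<Rightarrow> 'a \<Rightarrow> real"
  assumes "\<And>e. e > 0 \<Longrightarrow> AE x in M. eventually (\<lambda>N. \<bar>X N x - c\<bar> < e) sequentially"
  shows "AE x in M. (\<lambda>N. X N x) \<longlonglongrightarrow> c"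
proof -
  have "AE x in M. \<forall>m. eventually (\<lambda>N. \<bar>X N x - c\<bar> < 1 / real (Suc m)) sequentially"
    unfolding AE_all_countable using assms by simp
  then show ?thesis
  proof eventually_elim
    case (elim x)
    show ?case
      unfolding tendsto_iff dist_real_def
    proof safe
      fix e :: real assume "e > 0"
      then obtain m where "1 / real (Suc m) < e"
        using nat_approx_posE by (metis of_nat_Suc)
      with elim[rule_format, of m] show "eventually (\<lambda>N. \<bar>X N x - c\<bar> < e) sequentially"
        by (auto elim: eventually_mono)
    qed
  qed
qed

text \<open>The one-sided bound is applied to \<open>f\<close> and to its negative.\<close>

theorem birkhoff_ergodic_theorem:
  fixes f :: "'a \<Rightarrow> real"
  assumes f: "integrable M f"
  shows "AE x in M. (\<lambda>N. cesaro (\<lambda>_. f) N x) \<longlonglongrightarrow> (\<integral>x. f x \<partial>M)"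
proof (rule AE_tendsto_realI)
  fix e :: real assume e: "e > 0"
  have "AE x in M. eventually (\<lambda>N. cesaro (\<lambda>_. f) N x < (\<integral>x. f x \<partial>M) + e) sequentially"
    using e by (intro cesaro_eventually_le f) simp
  moreover have "AE x in M. eventually (\<lambda>N. cesaro (\<lambda>_ x. - f x) N x < (\<integral>x. - f x \<partial>M) + e) sequentially"
    using e f by (intro cesaro_eventually_le) simp_all
  ultimately show "AE x in M. eventually (\<lambda>N. \<bar>cesaro (\<lambda>_. f) N x - (\<integral>x. f x \<partial>M)\<bar> < e) sequentially"
  proof eventually_elim
    case (elim x)
    then show ?case by eventually_elim (auto simp: cesaro_uminus)
  qed
qed

text \<open>The averages of \<open>a - b\<close> are dominated by those of \<open>g\<close>, which
  eventually stay below any number above the integral of \<open>g\<close>. This works because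
  \<open>g\<close> is the same for all \<open>k\<close>.\<close>

lemma cesaro_approx:
  fixes a :: "nat \<Rightarrow> 'a \<Rightarrow> real"
  assumes "\<And>e. e > 0 \<Longrightarrow> \<exists>g b. integrable M g \<and> (\<integral>x. g x \<partial>M) < e \<and>
      (AE x in M. (\<lambda>N. cesaro b N x) \<longlonglongrightarrow> 0) \<and> (\<forall>k\<ge>1. AE x in M. \<bar>a k x - b k x\<bar> \<le> g x)"
  shows "AE x in M. (\<lambda>N. cesaro a N x) \<longlonglongrightarrow> 0"
proof (rule AE_tendsto_realI)
  fix e :: real assume "e > 0"
  then obtain g b where g: "integrable M g" "(\<integral>x. g x \<partial>M) < e / 2"
    and b: "AE x in M. (\<lambda>N. cesaro b N x) \<longlonglongrightarrow> 0"
    and le: "\<And>k. k \<ge> 1 \<Longrightarrow> AE x in M. \<bar>a k x - b k x\<bar> \<le> g x"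
    using assms[of "e / 2"] by auto
  have "AE x in M. \<bar>a k ((T ^^ k) x) - b k ((T ^^ k) x)\<bar> \<le> g ((T ^^ k) x)" if "k \<ge> 1" for k
    using AE_funpow[OF le[OF that], of k] by simp
  then have "AE x in M. \<forall>k. k \<ge> 1 \<longrightarrow> \<bar>a k ((T ^^ k) x) - b k ((T ^^ k) x)\<bar> \<le> g ((T ^^ k) x)"
    unfolding AE_all_countable by (auto intro: AE_I2)
  then show "AE x in M. eventually (\<lambda>N. \<bar>cesaro a N x - 0\<bar> < e) sequentially"
    using b cesaro_eventually_le[OF g]
  proof eventually_elim
    case (elim x)
    have "eventually (\<lambda>N. \<bar>cesaro b N x\<bar> < e / 2) sequentially"
      using elim(2)[THEN tendsto_rabs_zero] \<open>e > 0\<close> by (auto dest!: order_tendstoD(2)[of _ _ _ "e / 2"])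
    with elim(3) show ?case
    proof eventually_elim
      case (elim N)
      have "cesaro a N x - cesaro b N x \<le> cesaro (\<lambda>_. g) N x"
        "cesaro b N x - cesaro a N x \<le> cesaro (\<lambda>_. g) N x"
        unfolding cesaro_diff[symmetric]
        by (intro cesaro_mono; use \<open>\<forall>k. k \<ge> 1 \<longrightarrow> _ k\<close> in \<open>auto simp: abs_le_iff\<close>)+
      then show ?case using elim by linarith
    qed
  qed
qed

lemma cesaro_finite_support:
  assumes "\<And>k. k \<ge> m \<Longrightarrow> a k ((T ^^ k) x) = 0"
  shows "(\<lambda>N. cesaro a N x) \<longlonglongrightarrow> 0"
proof (rule Lim_transform_eventually)
  show "(\<lambda>N. (\<Sum>k=1..m. a k ((T ^^ k) x)) / real N) \<longlonglongrightarrow> 0"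
    by (rule lim_const_over_n)
  show "eventually (\<lambda>N. (\<Sum>k=1..m. a k ((T ^^ k) x)) / real N = cesaro a N x) sequentially"
    unfolding cesaro_def
  proof (intro eventually_sequentiallyI[of m] arg_cong2[of _ _ _ _ "(/)"] refl sum.mono_neutral_left)
    fix N assume "m \<le> N"
    then show "\<forall>i\<in>{1..N} - {1..m}. a i ((T ^^ i) x) = 0" using assms by auto
  qed auto
qed

text \<open>For \<open>m \<ge> 1\<close> the suprema of \<open>\<bar>d k\<bar>\<close> over
  \<open>k \<ge> m\<close> are dominated by \<open>H\<close>, and they tend to \<open>0\<close>
  almost surely, so their integrals tend to \<open>0\<close>. Replacing all late terms by zero
  therefore costs little on average.\<close>

lemma maker_ergodic_theorem:
  fixes d :: "nat \<Rightarrow> 'a \<Rightarrow> real"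
  assumes d [measurable]: "\<And>k. d k \<in> borel_measurable M"
    and H: "integrable M H"
    and bound: "\<And>k. k \<ge> 1 \<Longrightarrow> AE x in M. \<bar>d k x\<bar> \<le> H x"
    and lim: "AE x in M. (\<lambda>k. d k x) \<longlonglongrightarrow> 0"
  shows "AE x in M. (\<lambda>N. cesaro d N x) \<longlonglongrightarrow> 0"
proof (rule cesaro_approx)
  \<comment> \<open>The supremum is taken in the extended nonnegative reals, where it exists and is
    measurable. As \<open>enn2real\<close> sends \<open>\<infinity>\<close> to \<open>0\<close>,
    \<open>g m\<close> bounds the terms only where they are bounded, which \<open>H\<close> ensures
    almost everywhere for \<open>m \<ge> 1\<close>.\<close>
  define g where "g = (\<lambda>m x. enn2real (SUP k\<in>{m..}. ennreal \<bar>d k x\<bar>))"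
  have [measurable]: "g m \<in> borel_measurable M" for m
    unfolding g_def by measurable
  have g_le: "g m x \<le> c" if "\<And>k. k \<ge> m \<Longrightarrow> \<bar>d k x\<bar> \<le> c" "0 \<le> c" for m x c
    unfolding g_def using that by (intro enn2real_leI SUP_least) (auto intro: ennreal_leI)
  have g_ge: "\<bar>d k x\<bar> \<le> g m x" if "\<And>k. k \<ge> m \<Longrightarrow> \<bar>d k x\<bar> \<le> c" "m \<le> k" for k m x c
  proof -
    have "(SUP k\<in>{m..}. ennreal \<bar>d k x\<bar>) \<le> ennreal c"
      using that by (intro SUP_least) (auto intro: ennreal_leI)
    then have "enn2real (ennreal \<bar>d k x\<bar>) \<le> g m x"
      unfolding g_def using that(2)
      by (intro enn2real_mono SUP_upper) (auto intro: le_less_trans)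
    then show ?thesis by simp
  qed
  have "AE x in M. \<forall>k. k \<ge> 1 \<longrightarrow> \<bar>d k x\<bar> \<le> H x"
    unfolding AE_all_countable using bound by (auto intro: AE_I2)
  then have gb: "AE x in M. \<forall>m\<ge>1. (\<forall>k\<ge>m. \<bar>d k x\<bar> \<le> g m x) \<and> 0 \<le> g m x \<and> g m x \<le> H x"
  proof eventually_elim
    case (elim x)
    show ?case
    proof (intro allI impI conjI)
      fix m :: nat assume m: "m \<ge> 1"
      show "g m x \<le> H x"
        by (rule g_le) (use elim m abs_ge_zero order_trans in \<open>blast intro: order_trans\<close>)+
      show *: "\<bar>d k x\<bar> \<le> g m x" if "k \<ge> m" for k
        by (rule g_ge[of m x "H x"]) (use elim m that in auto)
      show "0 \<le> g m x" using *[of m] by simp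
    qed
  qed
  have gl: "AE x in M. (\<lambda>m. g m x) \<longlonglongrightarrow> 0"
    using gb lim
  proof eventually_elim
    case (elim x)
    show ?case
      unfolding LIMSEQ_def dist_real_def
    proof safe
      fix e :: real assume "e > 0"
      then obtain n where n: "\<And>k. k \<ge> n \<Longrightarrow> \<bar>d k x\<bar> < e / 2"
        using elim(2) unfolding LIMSEQ_def dist_real_def by (metis diff_zero half_gt_zero)
      have "\<bar>g m x\<bar> < e" if "m \<ge> max 1 n" for m
      proof -
        have "g m x \<le> e / 2" by (rule g_le) (use n that \<open>e > 0\<close> in \<open>auto intro: less_imp_le\<close>)
        then show ?thesis using elim(1) that \<open>e > 0\<close> by auto
      qed
      then show "\<exists>no. \<forall>m\<ge>no. \<bar>g m x - 0\<bar> < e" by (intro exI[of _ "max 1 n"]) simp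
    qed
  qed
  \<comment> \<open>The bound by \<open>H\<close> starts at \<open>k = 1\<close>, hence the tails
    start at \<open>Suc m\<close>.\<close>
  have "(\<lambda>m. \<integral>x. g (Suc m) x \<partial>M) \<longlonglongrightarrow> (\<integral>x. 0 \<partial>M)"
  proof (rule integral_dominated_convergence[OF _ _ H])
    show "AE x in M. (\<lambda>m. g (Suc m) x) \<longlonglongrightarrow> 0"
      using gl by eventually_elim (rule LIMSEQ_Suc)
    show "AE x in M. norm (g (Suc m) x) \<le> H x" for m
      using gb by eventually_elim auto
  qed simp_all
  moreover fix e :: real assume "e > 0"
  ultimately have "eventually (\<lambda>m. (\<integral>x. g (Suc m) x \<partial>M) < e) sequentially"
    by (auto dest: order_tendstoD)
  then obtain m where m: "(\<integral>x. g (Suc m) x \<partial>M) < e"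
    by (auto simp: eventually_sequentially)
  \<comment> \<open>The finitely many early terms are kept, since they may be large; their
    contribution to the averages vanishes in the limit.\<close>
  define b where "b = (\<lambda>k. if k < Suc m then d k else (\<lambda>_. 0))"
  show "\<exists>g b. integrable M g \<and> (\<integral>x. g x \<partial>M) < e \<and>
      (AE x in M. (\<lambda>N. cesaro b N x) \<longlonglongrightarrow> 0) \<and> (\<forall>k\<ge>1. AE x in M. \<bar>d k x - b k x\<bar> \<le> g x)"
  proof (intro exI conjI allI impI)
    show "integrable M (g (Suc m))"
    proof (rule Bochner_Integration.integrable_bound[OF H])
      show "AE x in M. norm (g (Suc m) x) \<le> norm (H x)"
        using gb
      proof eventually_elim
        case (elim x)
        have "norm (g (Suc m) x) \<le> H x" using elim by auto
        then show ?case by simp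
      qed
    qed simp
    show "AE x in M. (\<lambda>N. cesaro b N x) \<longlonglongrightarrow> 0"
      by (intro AE_I2 cesaro_finite_support[of "Suc m"]) (auto simp: b_def)
    show "AE x in M. \<bar>d k x - b k x\<bar> \<le> g (Suc m) x" for k
      using gb by eventually_elim (auto simp: b_def)
  qed fact
qed

end

section \<open>Strong laws for orthogonal increments\<close>

context prob_space
begin

text \<open>The sum of the squares has finite expectation, hence is finite almost surely, and then
  its terms tend to \<open>0\<close>.\<close>

lemma AE_tendsto_zero_if_second_moment_summable:
  fixes X :: "nat \<Rightarrow> 'a \<Rightarrow> real"
  assumes X: "\<And>m. integrable M (\<lambda>x. (X m x)\<^sup>2)" and [measurable]: "\<And>m. X m \<in> borel_measurable M"
    and le: "\<And>m. (\<integral>x. (X m x)\<^sup>2 \<partial>M) \<le> c m" and c: "summable c"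
  shows "AE x in M. (\<lambda>m. X m x) \<longlonglongrightarrow> 0"
proof -
  have c0: "0 \<le> c m" for m
    using le[of m] order_trans[OF integral_nonneg_AE] by (metis (mono_tags, lifting) AE_I2 zero_le_power2)
  have "(\<integral>\<^sup>+x. (\<Sum>m. ennreal ((X m x)\<^sup>2)) \<partial>M) = (\<Sum>m. \<integral>\<^sup>+x. ennreal ((X m x)\<^sup>2) \<partial>M)"
    by (intro nn_integral_suminf) measurable
  also have "\<dots> \<le> (\<Sum>m. ennreal (c m))"
    by (intro suminf_le summableI) (simp add: nn_integral_eq_integral[OF X] le ennreal_leI)
  also have "\<dots> = ennreal (\<Sum>m. c m)" using c c0 by (intro suminf_ennreal2)
  finally have "(\<integral>\<^sup>+x. (\<Sum>m. ennreal ((X m x)\<^sup>2)) \<partial>M) \<noteq> \<infinity>" by (auto simp: top_unique)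
  then have "AE x in M. (\<Sum>m. ennreal ((X m x)\<^sup>2)) \<noteq> \<infinity>"
    by (intro nn_integral_PInf_AE) auto
  then show ?thesis
  proof eventually_elim
    case (elim x)
    then have "summable (\<lambda>m. (X m x)\<^sup>2)" by (intro summable_suminf_not_top) auto
    then have "(\<lambda>m. sqrt ((X m x)\<^sup>2)) \<longlonglongrightarrow> sqrt 0"
      by (intro tendsto_real_sqrt summable_LIMSEQ_zero)
    then show ?case by (simp add: tendsto_rabs_zero_iff)
  qed
qed

lemma filterlim_floor_sqrt: "filterlim floor_sqrt at_top sequentially"
  unfolding filterlim_at_top
  by (auto simp: le_floor_sqrt_iff intro: eventually_ge_at_top)

text \<open>Along squares the second moments are summable, and between consecutive squares the sums of
  bounded variables move too little to matter.\<close>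

lemma bounded_orthogonal_strong_law:
  fixes d :: "nat \<Rightarrow> 'a \<Rightarrow> real"
  assumes d [measurable]: "\<And>k. d k \<in> borel_measurable M"
    and bound: "\<And>k. AE x in M. \<bar>d k x\<bar> \<le> R"
    and orth: "\<And>i k. 1 \<le> i \<Longrightarrow> i < k \<Longrightarrow> (\<integral>x. d i x * d k x \<partial>M) = 0"
  shows "AE x in M. (\<lambda>N. (\<Sum>k=1..N. d k x) / real N) \<longlonglongrightarrow> 0"
proof -
  define S where "S = (\<lambda>N x. \<Sum>k=1..N. d k x)"
  have [measurable]: "S N \<in> borel_measurable M" for N unfolding S_def by measurable
  have all_bound: "AE x in M. \<forall>k. \<bar>d k x\<bar> \<le> R"
    unfolding AE_all_countable using bound by simp
  have dd: "integrable M (\<lambda>x. d i x * d k x)" for i k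
  proof (rule integrable_const_bound[of _ "R * R"])
    show "AE x in M. norm (d i x * d k x) \<le> R * R"
      using all_bound by eventually_elim (auto simp: abs_mult intro: mult_mono order_trans[OF abs_ge_zero])
  qed simp
  have Sd: "integrable M (\<lambda>x. S N x * d k x)" for N k
    unfolding S_def sum_distrib_right by (intro Bochner_Integration.integrable_sum dd)
  have SS: "integrable M (\<lambda>x. (S N x)\<^sup>2)" for N
    unfolding S_def power2_eq_square sum_distrib_right sum_distrib_left
    by (intro Bochner_Integration.integrable_sum dd)
  have R0: "0 \<le> R"
    using all_bound by (metis (mono_tags, lifting) AE_False abs_ge_zero eventually_mono order_trans)
  \<comment> \<open>Orthogonality removes the cross terms, so the second moments of the sums grow
    only linearly.\<close>
  have moment: "(\<integral>x. (S N x)\<^sup>2 \<partial>M) \<le> real N * R\<^sup>2" for N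
  proof (induction N)
    case 0
    then show ?case by (simp add: S_def)
  next
    case (Suc N)
    have eq: "(S (Suc N) x)\<^sup>2 = (S N x)\<^sup>2 + 2 * (S N x * d (Suc N) x) + d (Suc N) x * d (Suc N) x" for x
      by (simp add: S_def power2_eq_square algebra_simps)
    have "(\<integral>x. S N x * d (Suc N) x \<partial>M) = (\<Sum>k=1..N. \<integral>x. d k x * d (Suc N) x \<partial>M)"
      unfolding S_def sum_distrib_right by (intro Bochner_Integration.integral_sum dd)
    also have "\<dots> = 0" by (intro sum.neutral ballI orth) auto
    finally have cross: "(\<integral>x. S N x * d (Suc N) x \<partial>M) = 0" .
    have "(\<integral>x. d (Suc N) x * d (Suc N) x \<partial>M) \<le> (\<integral>x. R\<^sup>2 \<partial>M)"
    proof (intro integral_mono_AE dd)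
      show "AE x in M. d (Suc N) x * d (Suc N) x \<le> R\<^sup>2"
        using all_bound
      proof eventually_elim
        case (elim x)
        then have "\<bar>d (Suc N) x\<bar>\<^sup>2 \<le> R\<^sup>2" by (intro power_mono) auto
        then show ?case by (simp add: power2_eq_square)
      qed
    qed simp
    then have "(\<integral>x. d (Suc N) x * d (Suc N) x \<partial>M) \<le> R\<^sup>2" by (simp add: prob_space)
    then show ?case
      unfolding eq using Suc cross SS[of N] Sd dd by (simp add: algebra_simps)
  qed
  \<comment> \<open>At time \<open>m\<^sup>2\<close> the average has second moment at most
    \<open>R\<^sup>2 / m\<^sup>2\<close>, which is summable.\<close>
  have squares: "AE x in M. (\<lambda>m. S (m\<^sup>2) x / real (m\<^sup>2)) \<longlonglongrightarrow> 0"
  proof (rule AE_tendsto_zero_if_second_moment_summable)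
    show "integrable M (\<lambda>x. (S (m\<^sup>2) x / real (m\<^sup>2))\<^sup>2)" for m
      using SS by (simp add: power_divide)
    show "(\<integral>x. (S (m\<^sup>2) x / real (m\<^sup>2))\<^sup>2 \<partial>M) \<le> R\<^sup>2 * inverse (real m ^ 2)" for m
    proof (cases "m = 0")
      case False
      have "(\<integral>x. (S (m\<^sup>2) x / real (m\<^sup>2))\<^sup>2 \<partial>M) = (\<integral>x. (S (m\<^sup>2) x)\<^sup>2 \<partial>M) / (real (m\<^sup>2))\<^sup>2"
        by (simp add: power_divide)
      also have "\<dots> \<le> real (m\<^sup>2) * R\<^sup>2 / (real (m\<^sup>2))\<^sup>2"
        using moment[of "m\<^sup>2"] by (intro divide_right_mono) auto
      also have "\<dots> = R\<^sup>2 * inverse (real m ^ 2)"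
        using False by (simp add: field_simps power2_eq_square)
      finally show ?thesis .
    qed simp
    show "summable (\<lambda>m. R\<^sup>2 * inverse (real m ^ 2))"
      by (intro summable_mult inverse_power_summable) simp
  qed simp
  from squares all_bound show ?thesis
  proof eventually_elim
    case (elim x)
    have close: "\<bar>S N x - S n x\<bar> \<le> real (N - n) * R" if "n \<le> N" for n N
    proof -
      have "S N x - S n x = (\<Sum>k\<in>{n<..N}. d k x)"
        unfolding S_def using that by (simp add: sum_diff[symmetric], intro sum.cong) auto
      also have "\<bar>\<dots>\<bar> \<le> (\<Sum>k\<in>{n<..N}. R)"
        using elim(2) by (intro order_trans[OF sum_abs] sum_mono) auto
      finally show ?thesis by simp
    qed
    have "(\<lambda>N. \<bar>S ((floor_sqrt N)\<^sup>2) x / real ((floor_sqrt N)\<^sup>2)\<bar> + 2 * R * inverse (real (floor_sqrt N))) \<longlonglongrightarrow> 0 + 2 * R * 0"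
      by (intro tendsto_intros tendsto_rabs_zero filterlim_compose[OF elim(1) filterlim_floor_sqrt]
          filterlim_compose[OF lim_inverse_n filterlim_floor_sqrt])
    then have lim: "(\<lambda>N. \<bar>S ((floor_sqrt N)\<^sup>2) x / real ((floor_sqrt N)\<^sup>2)\<bar> + 2 * R * inverse (real (floor_sqrt N))) \<longlonglongrightarrow> 0"
      by simp
    have "(\<lambda>N. S N x / real N) \<longlonglongrightarrow> 0"
    proof (rule Lim_null_comparison[OF _ lim], rule eventually_sequentiallyI[of 1])
      fix N :: nat assume N: "1 \<le> N"
      \<comment> \<open>The last square up to \<open>N\<close> is \<open>m\<^sup>2\<close>. At most
        \<open>2 * m\<close> bounded terms follow it, and they add at most
        \<open>2 * m * R / m\<^sup>2\<close> to the average.\<close>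
      define m where "m = floor_sqrt N"
      have m: "1 \<le> m" "m\<^sup>2 \<le> N" "N - m\<^sup>2 \<le> 2 * m"
        using N Suc_floor_sqrt_power2_gt[of N] floor_sqrt_power2_le[of N]
        by (auto simp: m_def le_floor_sqrt_iff power2_eq_square simp del: floor_sqrt_power2_le)
      have "\<bar>S N x\<bar> \<le> \<bar>S (m\<^sup>2) x\<bar> + real (N - m\<^sup>2) * R"
        using close[OF m(2)] by linarith
      also have "\<dots> \<le> \<bar>S (m\<^sup>2) x\<bar> + real (2 * m) * R"
        using m(3) R0 by (intro add_left_mono mult_right_mono) linarith+
      finally have "\<bar>S N x\<bar> / real N \<le> (\<bar>S (m\<^sup>2) x\<bar> + real (2 * m) * R) / real N"
        by (intro divide_right_mono) auto
      also have "\<dots> \<le> (\<bar>S (m\<^sup>2) x\<bar> + real (2 * m) * R) / real (m\<^sup>2)"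
        using m N R0 by (intro divide_left_mono) (auto simp del: of_nat_power intro!: mult_pos_pos)
      also have "\<dots> = \<bar>S (m\<^sup>2) x / real (m\<^sup>2)\<bar> + 2 * R * inverse (real m)"
        using m by (simp add: field_simps power2_eq_square)
      finally show "norm (S N x / real N) \<le> \<bar>S ((floor_sqrt N)\<^sup>2) x / real ((floor_sqrt N)\<^sup>2)\<bar> + 2 * R * inverse (real (floor_sqrt N))"
        by (simp add: m_def)
    qed
    then show ?case by (simp add: S_def)
  qed
qed

section \<open>Domination of conditional expectations\<close>

lemma sigma_finite_subalgebraI: "subalgebra M F \<Longrightarrow> sigma_finite_subalgebra M F"
  by (intro finite_measure_subalgebra_is_sigma_finite finite_measure_subalgebra.intro
      finite_measure_subalgebra_axioms.intro) unfold_locales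

lemma real_cond_exp_abs_le:
  assumes F: "subalgebra M F" and f: "integrable M f" and g: "integrable M g"
    and le: "AE x in M. \<bar>f x\<bar> \<le> g x"
  shows "AE x in M. \<bar>real_cond_exp M F f x\<bar> \<le> real_cond_exp M F g x"
proof -
  interpret F: sigma_finite_subalgebra M F using F by (rule sigma_finite_subalgebraI)
  have "AE x in M. real_cond_exp M F f x \<le> real_cond_exp M F g x"
    using le by (intro F.real_cond_exp_mono f g) auto
  moreover have "AE x in M. real_cond_exp M F (\<lambda>x. - 1 * f x) x \<le> real_cond_exp M F g x"
    using le f g by (intro F.real_cond_exp_mono) auto
  moreover have "AE x in M. real_cond_exp M F (\<lambda>x. - 1 * f x) x = - 1 * real_cond_exp M F f x"
    by (rule F.real_cond_exp_cmult[OF f])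
  ultimately show ?thesis by eventually_elim auto
qed

lemma real_cond_exp_abs_le_const:
  assumes F: "subalgebra M F" and f [measurable]: "f \<in> borel_measurable M"
    and le: "AE x in M. \<bar>f x\<bar> \<le> c"
  shows "AE x in M. \<bar>real_cond_exp M F f x\<bar> \<le> c"
proof -
  interpret F: sigma_finite_subalgebra M F using F by (rule sigma_finite_subalgebraI)
  have fi: "integrable M f" using le by (intro integrable_const_bound[of _ c]) auto
  have "AE x in M. real_cond_exp M F f x \<le> c"
    by (rule F.real_cond_exp_le_c[OF fi]) (use le in \<open>eventually_elim, linarith\<close>)
  moreover have "AE x in M. real_cond_exp M F f x \<ge> - c"
    by (rule F.real_cond_exp_ge_c[OF fi]) (use le in \<open>eventually_elim, linarith\<close>)
  ultimately show ?thesis by eventually_elim linarith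
qed

end

section \<open>Increments of conditional expectations along the orbit\<close>

context ergodic_map
begin

text \<open>One application of \<open>\<tau>\<close> pulls \<open>G\<close> back into
  \<open>F\<close>. As \<open>F\<close> is coarser than \<open>G\<close>, \<open>\<tau>\<close> also
  pulls \<open>F\<close> back into itself, so the other \<open>p - 1\<close> applications stay
  there. For \<open>p = 0\<close> there would be no passage from \<open>G\<close> to
  \<open>F\<close>.\<close>

lemma measurable_inverse_funpow:
  assumes FG: "subalgebra G F" and \<tau>: "\<tau> \<in> measurable F G" and p: "1 \<le> p"
  shows "\<tau> ^^ p \<in> measurable F G"
proof -
  have "\<tau> \<in> measurable F F"
    using FG \<tau> unfolding subalgebra_def measurable_def by auto
  then have "\<tau> ^^ (p - 1) \<in> measurable F F" by (rule measurable_compose_n)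
  then have "\<tau> \<circ> \<tau> ^^ (p - 1) \<in> measurable F G" using \<tau> by (rule measurable_comp)
  moreover have "\<tau> ^^ p = \<tau> \<circ> \<tau> ^^ (p - 1)" using p by (cases p) auto
  ultimately show ?thesis by simp
qed

lemma inverse_funpow:
  assumes "\<And>x. x \<in> space M \<Longrightarrow> \<tau> (T x) = x" and "x \<in> space M" and "i \<le> k"
  shows "(\<tau> ^^ (k - i)) ((T ^^ k) x) = (T ^^ i) x"
proof -
  have "(\<tau> ^^ p) ((T ^^ (p + i)) x) = (T ^^ i) x" for p
  proof (induction p)
    case (Suc p)
    have "(T ^^ (p + i)) x \<in> space M" using assms(2) measurable_space[OF funpow_measurable] by blast
    then have "\<tau> ((T ^^ (Suc p + i)) x) = (T ^^ (p + i)) x" using assms(1) by simp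
    then show ?case using Suc by (simp only: funpow_Suc_right o_apply)
  qed simp
  from this[of "k - i"] show ?thesis using assms(3) by simp
qed

text \<open>In contrast to \<open>AE_funpow\<close>, this also removes a power of \<open>T\<close>;
  the predicate is assumed measurable.\<close>

lemma AE_funpow_iff:
  assumes [measurable]: "Measurable.pred M P"
  shows "(AE x in M. P ((T ^^ n) x)) \<longleftrightarrow> (AE x in M. P x)"
  using AE_distr_iff[OF funpow_measurable[of n], of P] assms unfolding distr_funpow by (simp add: pred_def)

text \<open>Let \<open>e\<^sub>k = E[f\<^sub>k|G] - E[f\<^sub>k|F]\<close>. For \<open>i < k\<close> the variable \<open>e\<^sub>i \<circ> T\<^sup>i\<close> is \<open>h \<circ> T\<^sup>k\<close> with
  \<open>h = e\<^sub>i \<circ> \<tau>\<^sup>k\<^sup>-\<^sup>i\<close> measurable for \<open>F\<close>, so that \<open>e\<^sub>i \<circ> T\<^sup>i\<close> and \<open>e\<^sub>k \<circ> T\<^sup>k\<close> are orthogonal.\<close>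

lemma cond_exp_increments_orthogonal:
  assumes G: "subalgebra M G" and FG: "subalgebra G F" and \<tau>: "\<tau> \<in> measurable F G"
    and inv: "\<And>x. x \<in> space M \<Longrightarrow> \<tau> (T x) = x"
    and f [measurable]: "\<And>k. f k \<in> borel_measurable M"
    and bound: "\<And>k. AE x in M. \<bar>f k x\<bar> \<le> R"
    and ik: "i < k"
  defines "e \<equiv> \<lambda>k x. real_cond_exp M G (f k) x - real_cond_exp M F (f k) x"
  shows "(\<integral>x. e i ((T ^^ i) x) * e k ((T ^^ k) x) \<partial>M) = 0"
proof -
  have F: "subalgebra M F" using G FG unfolding subalgebra_def by auto
  interpret F: sigma_finite_subalgebra M F using F by (rule sigma_finite_subalgebraI)
  interpret G: sigma_finite_subalgebra M G using G by (rule sigma_finite_subalgebraI)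
  have fi: "integrable M (f k)" for k
    using bound by (intro integrable_const_bound[of _ R]) auto
  have "AE x in M. \<bar>real_cond_exp M H (f k) x\<bar> \<le> R" if "subalgebra M H" for H k
    using that bound by (intro real_cond_exp_abs_le_const) auto
  note ce_bound = this[OF F] this[OF G]
  have eb: "AE x in M. \<bar>e k x\<bar> \<le> 2 * R" for k
    using ce_bound[of k] unfolding e_def by eventually_elim linarith
  have eG: "e k \<in> borel_measurable G" for k
    unfolding e_def using measurable_from_subalg[OF FG borel_measurable_cond_exp] by measurable
  define h where "h = (\<lambda>x. e i ((\<tau> ^^ (k - i)) x))"
  have hF: "h \<in> borel_measurable F"
    unfolding h_def using measurable_comp[OF measurable_inverse_funpow[OF FG \<tau>] eG, of "k - i" i] ik
    by (simp add: comp_def)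
  have hG: "h \<in> borel_measurable G" by (rule measurable_from_subalg[OF FG hF])
  have [measurable]: "h \<in> borel_measurable M" by (rule measurable_from_subalg[OF F hF])
  have [measurable]: "e k \<in> borel_measurable M" for k by (rule measurable_from_subalg[OF G eG])
  have hT: "h ((T ^^ k) x) = e i ((T ^^ i) x)" if "x \<in> space M" for x
    unfolding h_def using inverse_funpow[OF inv that, of i k] ik by simp
  \<comment> \<open>The bound on \<open>h\<close> is inherited from \<open>e i\<close> through
    \<open>h ((T ^^ k) x) = e i ((T ^^ i) x)\<close> and then brought back from
    \<open>(T ^^ k) x\<close> to \<open>x\<close>.\<close>
  have "AE x in M. \<bar>h ((T ^^ k) x)\<bar> \<le> 2 * R"
    using AE_funpow[OF eb, of i i] AE_space by eventually_elim (simp add: hT)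
  then have hb: "AE x in M. \<bar>h x\<bar> \<le> 2 * R"
    by (subst (asm) AE_funpow_iff) auto
  have hf: "integrable M (\<lambda>x. h x * f k x)"
  proof (rule integrable_const_bound[of _ "(2 * R) * R"])
    show "AE x in M. norm (h x * f k x) \<le> 2 * R * R"
      using hb bound[of k]
    proof eventually_elim
      case (elim x)
      then show ?case by (simp add: abs_mult mult_mono order_trans[OF abs_ge_zero])
    qed
  qed simp
  have "(\<integral>x. e i ((T ^^ i) x) * e k ((T ^^ k) x) \<partial>M) = (\<integral>x. h ((T ^^ k) x) * e k ((T ^^ k) x) \<partial>M)"
    by (rule Bochner_Integration.integral_cong) (auto simp: hT)
  also have "\<dots> = (\<integral>x. h x * e k x \<partial>M)"
    using integral_funpow[of "\<lambda>x. h x * e k x" k] by simp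
  also have "\<dots> = (\<integral>x. h x * real_cond_exp M G (f k) x - h x * real_cond_exp M F (f k) x \<partial>M)"
    by (simp add: e_def right_diff_distrib)
  \<comment> \<open>As \<open>h\<close> is measurable for both fields, both integrals equal the
    integral of \<open>h x * f k x\<close>.\<close>
  also have "\<dots> = 0"
    using F.real_cond_exp_intg[OF hf hF] G.real_cond_exp_intg[OF hf hG] by simp
  finally show ?thesis .
qed

text \<open>Truncation reduces the claim to bounded orthogonal increments. The part cut off is
  controlled, uniformly in \<open>k\<close>, by the integral of \<open>\<Lambda>\<close> over the
  set where \<open>\<Lambda>\<close> is large.\<close>

lemma cond_exp_increments_strong_law:
  fixes f :: "nat \<Rightarrow> 'a \<Rightarrow> real"
  assumes G: "subalgebra M G" and FG: "subalgebra G F" and \<tau>: "\<tau> \<in> measurable F G"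
    and inv: "\<And>x. x \<in> space M \<Longrightarrow> \<tau> (T x) = x"
    and f [measurable]: "\<And>k. f k \<in> borel_measurable M"
    and L: "integrable M \<Lambda>" and bound: "\<And>k x. x \<in> space M \<Longrightarrow> \<bar>f k x\<bar> \<le> \<Lambda> x"
  shows "AE x in M. (\<lambda>N. cesaro (\<lambda>k x. real_cond_exp M G (f k) x - real_cond_exp M F (f k) x) N x) \<longlonglongrightarrow> 0"
proof (rule cesaro_approx)
  have F: "subalgebra M F" using G FG unfolding subalgebra_def by auto
  interpret F: sigma_finite_subalgebra M F using F by (rule sigma_finite_subalgebraI)
  interpret G: sigma_finite_subalgebra M G using G by (rule sigma_finite_subalgebraI)
  note [measurable] = L[THEN borel_measurable_integrable]
  define tail where "tail = (\<lambda>R::nat. \<lambda>x. \<Lambda> x * indicator {x. \<Lambda> x > real R} x)"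
  have [measurable]: "tail R \<in> borel_measurable M" for R unfolding tail_def by measurable
  have tail_int: "integrable M (tail R)" for R
    by (rule Bochner_Integration.integrable_bound[OF L]) (auto simp: tail_def indicator_def)
  have "(\<lambda>R. \<integral>x. tail R x \<partial>M) \<longlonglongrightarrow> (\<integral>x. 0 \<partial>M)"
  proof (rule integral_dominated_convergence[OF _ _ integrable_abs[OF L]])
    show "AE x in M. (\<lambda>R. tail R x) \<longlonglongrightarrow> 0"
    proof (rule AE_I2)
      fix x
      obtain n :: nat where "\<Lambda> x \<le> real n" using real_arch_simple by blast
      then show "(\<lambda>R. tail R x) \<longlonglongrightarrow> 0"
        by (intro tendsto_eventually eventually_sequentiallyI[of n]) (auto simp: tail_def indicator_def)
    qed
  qed (auto simp: tail_def indicator_def)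
  moreover fix \<epsilon> :: real assume \<epsilon>: "\<epsilon> > 0"
  ultimately have "eventually (\<lambda>R. (\<integral>x. tail R x \<partial>M) < \<epsilon> / 2) sequentially"
    by (auto dest!: order_tendstoD(2)[of _ _ _ "\<epsilon> / 2"])
  then obtain R where R: "(\<integral>x. tail R x \<partial>M) < \<epsilon> / 2"
    by (auto simp: eventually_sequentially)
  \<comment> \<open>All \<open>f k\<close> are cut on the same set, and \<open>tail R\<close>
    dominates every part cut off.\<close>
  define f' where "f' = (\<lambda>k x. if \<Lambda> x \<le> real R then f k x else 0)"
  define f'' where "f'' = (\<lambda>k x. if \<Lambda> x \<le> real R then 0 else f k x)"
  have [measurable]: "f' k \<in> borel_measurable M" "f'' k \<in> borel_measurable M" for k
    unfolding f'_def f''_def by measurable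
  have f'b: "AE x in M. \<bar>f' k x\<bar> \<le> real R" for k
  proof (rule AE_I2)
    fix x assume "x \<in> space M"
    then show "\<bar>f' k x\<bar> \<le> real R" using bound[of x k] by (auto simp: f'_def)
  qed
  have f''b: "AE x in M. \<bar>f'' k x\<bar> \<le> tail R x" for k
  proof (rule AE_I2)
    fix x assume "x \<in> space M"
    then show "\<bar>f'' k x\<bar> \<le> tail R x" using bound[of x k] by (auto simp: f''_def tail_def)
  qed
  have int: "integrable M (f k)" "integrable M (f' k)" "integrable M (f'' k)" for k
  proof -
    show "integrable M (f' k)" using f'b by (intro integrable_const_bound[of _ "real R"]) auto
    show "integrable M (f'' k)"
      by (rule Bochner_Integration.integrable_bound[OF tail_int[of R]]) (simp, use f''b[of k] in \<open>eventually_elim, simp\<close>)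
    show "integrable M (f k)"
      by (rule Bochner_Integration.integrable_bound[OF L]) (use bound[of _ k] in \<open>simp_all add: order_trans[OF _ abs_ge_self]\<close>)
  qed
  have split: "AE x in M. real_cond_exp M H (f k) x = real_cond_exp M H (f' k) x + real_cond_exp M H (f'' k) x"
    if "subalgebra M H" for H k
  proof -
    interpret H: sigma_finite_subalgebra M H using that by (rule sigma_finite_subalgebraI)
    have "(\<lambda>x. f' k x + f'' k x) = f k" by (auto simp: f'_def f''_def)
    then show ?thesis using H.real_cond_exp_add[OF int(2,3)[of k]] by simp
  qed
  \<comment> \<open>Each of the two conditional expectations has the same integral as
    \<open>tail R\<close>, which is less than \<open>\<epsilon> / 2\<close>.\<close>
  define g where "g = (\<lambda>x. real_cond_exp M G (tail R) x + real_cond_exp M F (tail R) x)"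
  define b where "b = (\<lambda>k x. real_cond_exp M G (f' k) x - real_cond_exp M F (f' k) x)"
  show "\<exists>g b. integrable M g \<and> (\<integral>x. g x \<partial>M) < \<epsilon> \<and> (AE x in M. (\<lambda>N. cesaro b N x) \<longlonglongrightarrow> 0) \<and>
    (\<forall>k\<ge>1. AE x in M. \<bar>(real_cond_exp M G (f k) x - real_cond_exp M F (f k) x) - b k x\<bar> \<le> g x)"
  proof (intro exI conjI allI impI)
    show "integrable M g" "(\<integral>x. g x \<partial>M) < \<epsilon>"
      unfolding g_def using F.real_cond_exp_int[OF tail_int] G.real_cond_exp_int[OF tail_int] R by auto
    show "AE x in M. \<bar>(real_cond_exp M G (f k) x - real_cond_exp M F (f k) x) - b k x\<bar> \<le> g x" for k
      using split[OF F, of k] split[OF G, of k]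
        real_cond_exp_abs_le[OF F int(3) tail_int f''b, of k] real_cond_exp_abs_le[OF G int(3) tail_int f''b, of k]
      unfolding b_def g_def by eventually_elim linarith
    have "AE x in M. (\<lambda>N. (\<Sum>k=1..N. b k ((T ^^ k) x)) / real N) \<longlonglongrightarrow> 0"
    proof (rule bounded_orthogonal_strong_law)
      show "(\<lambda>x. b k ((T ^^ k) x)) \<in> borel_measurable M" for k
        unfolding b_def by measurable
      show "(\<integral>x. b i ((T ^^ i) x) * b k ((T ^^ k) x) \<partial>M) = 0" if "i < k" for i k
        unfolding b_def using that by (intro cond_exp_increments_orthogonal[OF G FG \<tau> inv _ f'b]) auto
      have "AE x in M. \<bar>b k x\<bar> \<le> 2 * real R" for k
      proof -
        have "AE x in M. \<bar>real_cond_exp M H (f' k) x\<bar> \<le> real R" if "subalgebra M H" for H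
          using that f'b by (intro real_cond_exp_abs_le_const) auto
        from this[OF F] this[OF G] show ?thesis
          unfolding b_def by eventually_elim linarith
      qed
      then show "AE x in M. \<bar>b k ((T ^^ k) x)\<bar> \<le> 2 * real R" for k by (rule AE_funpow)
    qed
    then show "AE x in M. (\<lambda>N. cesaro b N x) \<longlonglongrightarrow> 0" by (simp add: cesaro_def)
  qed
qed

end

section \<open>Essential suprema and infima\<close>

text \<open>Maximize \<open>E[SUP i\<in>J. arctan (f i)]\<close> over the countable \<open>J \<subseteq> I\<close>; adding an index to a maximizer
  changes the supremum on a null set only. (The summand \<open>2\<close> makes the values nonnegative.)\<close>

lemma (in prob_space) is_ess_sup_exists:
  fixes f :: "'i \<Rightarrow> 'a \<Rightarrow> real"
  assumes f: "\<And>i. i \<in> I \<Longrightarrow> f i \<in> borel_measurable M"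
  shows "\<exists>Z. is_ess_sup M I f Z"
proof -
  define h where "h = (\<lambda>i x. ennreal (arctan (f i x) + 2))"
  have h [measurable]: "h i \<in> borel_measurable M" if "i \<in> I" for i
  proof -
    note f[OF that, measurable]
    show ?thesis unfolding h_def by measurable
  qed
  have arctan2: "0 \<le> arctan r + 2" "arctan r + 2 \<le> 4" for r
    using arctan_lbound[of r] arctan_ubound[of r] pi_less_4 by linarith+
  have h_le: "h i x \<le> 4" for i x
  proof -
    have "h i x \<le> ennreal 4" unfolding h_def using arctan2 by (intro ennreal_leI)
    then show ?thesis by simp
  qed
  define s where "s = (\<lambda>J x. SUP i\<in>J. h i x)"
  have s [measurable]: "s J \<in> borel_measurable M" if "countable J" "J \<subseteq> I" for J
    unfolding s_def using that h by (intro borel_measurable_SUP) auto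
  define g where "g = (\<lambda>J. \<integral>\<^sup>+x. s J x \<partial>M)"
  define \<J> where "\<J> = {J. countable J \<and> J \<subseteq> I}"
  have "{} \<in> \<J>" by (simp add: \<J>_def)
  then have "g ` \<J> \<noteq> {}" by blast
  then obtain c where c: "range c \<subseteq> g ` \<J>" "Sup (g ` \<J>) = (SUP n::nat. c n)"
    using ennreal_Sup_countable_SUP by metis
  then have "\<exists>J\<in>\<J>. c n = g J" for n by blast
  then obtain K where K: "\<And>n. K n \<in> \<J>" "\<And>n. c n = g (K n)" by metis
  define J where "J = (\<Union>n. K n)"
  have J: "countable J" "J \<subseteq> I" using K(1) unfolding J_def \<J>_def by auto
  have g_mono: "A \<subseteq> B \<Longrightarrow> g A \<le> g B" for A B
    unfolding g_def s_def by (intro nn_integral_mono SUP_subset_mono) auto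
  have max: "g A \<le> g J" if "A \<in> \<J>" for A
  proof -
    have "g A \<le> (SUP n. c n)" unfolding c(2)[symmetric] using that by (intro SUP_upper)
    also have "\<dots> \<le> g J" unfolding K(2) J_def by (intro SUP_least g_mono) auto
    finally show ?thesis .
  qed
  have "g J \<le> (\<integral>\<^sup>+x. 4 \<partial>M)"
    unfolding g_def s_def by (intro nn_integral_mono SUP_least h_le)
  then have gJ: "g J \<noteq> \<infinity>" by (auto simp: emeasure_space_1 top_unique)
  define Z where "Z = (\<lambda>x. SUP i\<in>J. ereal (f i x))"
  have "is_ess_sup M I f Z"
    unfolding is_ess_sup_def
  proof (intro conjI ballI impI)
    show "Z \<in> borel_measurable M"
      unfolding Z_def using J f by (intro borel_measurable_SUP) auto
  next
    fix i assume i: "i \<in> I"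
    have ins: "insert i J \<in> \<J>" using i J by (simp add: \<J>_def)
    have sub: "s J x \<le> s (insert i J) x" for x
      unfolding s_def by (intro SUP_subset_mono) auto
    \<comment> \<open>Otherwise the supremum would grow on a set of positive measure and, the
      integral for \<open>J\<close> being finite, \<open>insert i J\<close> would beat the
      maximizer.\<close>
    have "AE x in M. s (insert i J) x \<le> s J x"
    proof (rule ccontr)
      assume "\<not> ?thesis"
      then have "g J < g (insert i J)"
        unfolding g_def using J i gJ sub by (intro nn_integral_less) (auto simp: g_def)
      then show False using max[OF ins] by simp
    qed
    then show "AE x in M. ereal (f i x) \<le> Z x"
    proof eventually_elim
      case (elim x)
      show ?case
      proof (rule ccontr)
        assume "\<not> ?thesis"
        then have "Z x < ereal (f i x)" by simp
        \<comment> \<open>The level \<open>r\<close> separates the values of \<open>J\<close> at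
          \<open>x\<close> from \<open>f i x\<close>; strict monotonicity of \<open>arctan\<close>
          carries the separation over to \<open>h\<close>.\<close>
        then obtain r where r: "Z x < ereal r" "ereal r < ereal (f i x)"
          using ereal_dense2 by blast
        have "s J x \<le> ennreal (arctan r + 2)"
          unfolding s_def h_def
        proof (intro SUP_least ennreal_leI)
          fix j assume "j \<in> J"
          then have "ereal (f j x) \<le> Z x" unfolding Z_def by (rule SUP_upper)
          then have "ereal (f j x) < ereal r" using r(1) by (rule le_less_trans)
          then show "arctan (f j x) + 2 \<le> arctan r + 2" by (simp add: arctan_le_iff)
        qed
        also have "\<dots> < h i x"
          unfolding h_def
        proof (rule ennreal_lessI)
          show "arctan r + 2 < arctan (f i x) + 2" using r(2) by (simp add: arctan_less_iff)
          then show "0 < arctan (f i x) + 2" using arctan2(1)[of r] by linarith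
        qed
        also have "h i x \<le> s (insert i J) x" unfolding s_def by (intro SUP_upper) simp
        finally show False using elim by simp
      qed
    qed
  next
    fix Z' :: "'a \<Rightarrow> ereal"
    assume "\<forall>i\<in>I. AE x in M. ereal (f i x) \<le> Z' x"
    then have "AE x in M. \<forall>j\<in>J. ereal (f j x) \<le> Z' x"
      using J by (subst AE_ball_countable) auto
    then show "AE x in M. Z x \<le> Z' x"
      unfolding Z_def by eventually_elim (auto intro: SUP_least)
  qed
  then show ?thesis by blast
qed

lemma (in prob_space) is_ess_inf_exists:
  fixes f :: "'i \<Rightarrow> 'a \<Rightarrow> real"
  assumes "\<And>i. i \<in> I \<Longrightarrow> f i \<in> borel_measurable M"
  shows "\<exists>Z. is_ess_inf M I f Z"
proof -
  obtain Z where Z: "is_ess_sup M I (\<lambda>i x. - f i x) Z"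
    using is_ess_sup_exists[of I "\<lambda>i x. - f i x"] assms by auto
  have "is_ess_inf M I f (\<lambda>x. - Z x)"
    unfolding is_ess_inf_def
  proof (intro conjI ballI impI)
    show "(\<lambda>x. - Z x) \<in> borel_measurable M" using Z by (auto simp: is_ess_sup_def)
    fix i assume "i \<in> I"
    then have "AE x in M. ereal (- f i x) \<le> Z x" using Z by (auto simp: is_ess_sup_def)
    then show "AE x in M. - Z x \<le> ereal (f i x)"
      by eventually_elim (metis ereal_uminus_le_reorder uminus_ereal.simps(1))
  next
    fix Z' :: "'a \<Rightarrow> ereal"
    assume [measurable]: "Z' \<in> borel_measurable M" and le: "\<forall>i\<in>I. AE x in M. Z' x \<le> ereal (f i x)"
    have "\<forall>i\<in>I. AE x in M. ereal (- f i x) \<le> - Z' x"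
    proof
      fix i assume "i \<in> I"
      with le have "AE x in M. Z' x \<le> ereal (f i x)" by blast
      then show "AE x in M. ereal (- f i x) \<le> - Z' x"
        by eventually_elim (simp flip: uminus_ereal.simps)
    qed
    moreover have "(\<lambda>x. - Z' x) \<in> borel_measurable M" by measurable
    moreover have "\<forall>Z'\<in>borel_measurable M. (\<forall>i\<in>I. AE x in M. ereal (- f i x) \<le> Z' x) \<longrightarrow> (AE x in M. Z x \<le> Z' x)"
      using Z by (simp add: is_ess_sup_def)
    ultimately have "AE x in M. Z x \<le> - Z' x" by (auto dest: bspec)
    then show "AE x in M. Z' x \<le> - Z x"
    proof eventually_elim
      case (elim x)
      then show ?case using ereal_minus_le_minus[of "- Z x" "Z' x"] by simp
    qed
  qed
  then show ?thesis by blast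
qed

lemma (in prob_space) is_ess_sup_ess_sup:
  fixes f :: "'i \<Rightarrow> 'a \<Rightarrow> real"
  assumes "\<And>i. i \<in> I \<Longrightarrow> f i \<in> borel_measurable M"
  shows "is_ess_sup M I f (ess_sup M I f)"
  unfolding ess_sup_def by (rule someI_ex[OF is_ess_sup_exists[OF assms]])

lemma (in prob_space) is_ess_inf_ess_inf:
  fixes f :: "'i \<Rightarrow> 'a \<Rightarrow> real"
  assumes "\<And>i. i \<in> I \<Longrightarrow> f i \<in> borel_measurable M"
  shows "is_ess_inf M I f (ess_inf M I f)"
  unfolding ess_inf_def by (rule someI_ex[OF is_ess_inf_exists[OF assms]])

text \<open>Puts convergence in the mean into the form required by \<open>cesaro_approx\<close>. A
  finite integral makes \<open>Z n\<close> finite almost surely; the bound on all real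
  \<open>r\<close> below \<open>Z n x\<close> then applies directly to the members of a family with
  essential supremum \<open>Z n\<close>.\<close>

lemma (in prob_space) L1_tendsto_zero_dominating:
  assumes Z: "\<And>n. Z n \<in> borel_measurable M" and lim: "L1_tendsto_zero M Z" and e: "0 < e"
  shows "eventually (\<lambda>n. \<exists>g. integrable M g \<and> (\<integral>x. g x \<partial>M) < e \<and>
    (AE x in M. \<forall>r. ereal r \<le> Z n x \<longrightarrow> r \<le> g x)) sequentially"
proof -
  have "eventually (\<lambda>n. (\<integral>\<^sup>+x. e2ennreal \<bar>Z n x\<bar> \<partial>M) < ennreal e) sequentially"
    using lim e unfolding L1_tendsto_zero_def by (intro order_tendstoD(2)[of _ 0]) auto
  then show ?thesis
  proof eventually_elim
    case (elim n)
    note [measurable] = Z[of n]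
    let ?z = "\<lambda>x. e2ennreal \<bar>Z n x\<bar>"
    have fin: "(\<integral>\<^sup>+x. ?z x \<partial>M) < \<infinity>" using elim by (rule less_trans) simp
    then have AE_fin: "AE x in M. ?z x \<noteq> \<infinity>" by (intro nn_integral_PInf_AE) auto
    have eq: "(\<integral>\<^sup>+x. ennreal (enn2real (?z x)) \<partial>M) = (\<integral>\<^sup>+x. ?z x \<partial>M)"
    proof (rule nn_integral_cong_AE)
      show "AE x in M. ennreal (enn2real (?z x)) = ?z x"
        using AE_fin by eventually_elim (simp add: less_top)
    qed
    have int: "integrable M (\<lambda>x. enn2real (?z x))"
      using fin by (intro integrableI_nonneg) (simp_all add: eq)
    then have "ennreal (\<integral>x. enn2real (?z x) \<partial>M) < ennreal e"
      using elim nn_integral_eq_integral[OF int] by (simp add: eq)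
    then have "(\<integral>x. enn2real (?z x) \<partial>M) < e"
      using e by (simp add: ennreal_less_iff)
    moreover have "AE x in M. \<forall>r. ereal r \<le> Z n x \<longrightarrow> r \<le> enn2real (?z x)"
      using AE_fin
    proof eventually_elim
      case (elim x)
      show ?case
      proof safe
        fix r assume r: "ereal r \<le> Z n x"
        show "r \<le> enn2real (?z x)"
        proof (cases "0 \<le> r")
          case True
          have "ennreal r = e2ennreal (ereal r)" by (simp add: e2ennreal_ereal)
          also have "\<dots> \<le> ?z x" using r by (intro e2ennreal_mono) (cases "Z n x"; auto)
          finally have "enn2real (ennreal r) \<le> enn2real (?z x)"
            using elim by (intro enn2real_mono) (auto simp: less_top)
          then show ?thesis using True by simp
        next
          case False
          then show ?thesis using enn2real_nonneg[of "?z x"] by linarith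
        qed
      qed
    qed
    ultimately show ?case using int by blast
  qed
qed

section \<open>Shifted fields\<close>

locale invertible_ergodic_map = ergodic_map +
  assumes bij_T: "bij_betw T (space M) (space M)"
    and inv_measurable [measurable]: "inv_into (space M) T \<in> measurable M M"
begin

lemma inv_T: "x \<in> space M \<Longrightarrow> inv_into (space M) T (T x) = x"
  using bij_T by (simp add: bij_betw_def)

lemma T_inv: "x \<in> space M \<Longrightarrow> T (inv_into (space M) T x) = x"
  using bij_T by (simp add: bij_betw_inv_into_right)

lemma iter_measurable [measurable]: "iter M T k \<in> measurable M M"
  unfolding iter_def by (simp add: measurable_compose_n[OF inv_measurable])

lemma iter_space [simp]: "x \<in> space M \<Longrightarrow> iter M T k x \<in> space M"
  using measurable_space[OF iter_measurable] .

lemma iter_0 [simp]: "iter M T 0 x = x"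
  by (simp add: iter_def)

lemma iter_nat: "iter M T (int n) = T ^^ n"
  by (simp add: iter_def)

lemma iter_Suc: "x \<in> space M \<Longrightarrow> iter M T (k + 1) x = T (iter M T k x)"
proof (cases "0 \<le> k")
  case True
  then show ?thesis by (simp add: iter_def nat_add_distrib)
next
  case False
  define n where "n = nat (- k - 1)"
  have k: "k = - int (Suc n)" using False by (simp add: n_def)
  assume x: "x \<in> space M"
  have "(inv_into (space M) T ^^ n) x \<in> space M"
    using measurable_space[OF measurable_compose_n[OF inv_measurable] x] .
  then show ?thesis by (cases n) (auto simp: k iter_def T_inv nat_add_distrib)
qed

lemma iter_pred: "x \<in> space M \<Longrightarrow> iter M T (k - 1) x = inv_into (space M) T (iter M T k x)"
  using iter_Suc[of x "k - 1"] inv_T[of "iter M T (k - 1) x"] by simp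

lemma iter_add: "x \<in> space M \<Longrightarrow> iter M T (a + b) x = iter M T a (iter M T b x)"
proof (induction a rule: int_induct[where k = 0])
  case (step1 i)
  then show ?case using iter_Suc[of x "i + b"] iter_Suc[of "iter M T b x" i] by (simp add: algebra_simps)
next
  case (step2 i)
  then show ?case using iter_pred[of x "i + b"] iter_pred[of "iter M T b x" i] by (simp add: algebra_simps)
qed simp

text \<open>On \<open>space M\<close> the powers for \<open>k\<close> and \<open>- k\<close> are
  inverse to each other. Writing images as preimages makes the shifted sets measurable.\<close>

lemma iter_image:
  assumes "A \<subseteq> space M"
  shows "iter M T k ` A = iter M T (- k) -` A \<inter> space M"
proof (intro equalityI subsetI)
  fix y assume "y \<in> iter M T k ` A"
  then obtain x where "x \<in> A" "y = iter M T k x" by blast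
  moreover from this have "x \<in> space M" using assms by auto
  ultimately show "y \<in> iter M T (- k) -` A \<inter> space M" by (simp flip: iter_add)
next
  fix x assume "x \<in> iter M T (- k) -` A \<inter> space M"
  then have x: "x \<in> space M" "iter M T (- k) x \<in> A" by auto
  have "x = iter M T k (iter M T (- k) x)" using x(1) by (simp flip: iter_add)
  then show "x \<in> iter M T k ` A" using x(2) by blast
qed

lemma iter_vimage_image:
  assumes "A \<subseteq> space M"
  shows "iter M T a -` (iter M T b ` A) \<inter> space M = iter M T (b - a) ` A"
  using iter_image[OF assms, of b] iter_image[OF assms, of "b - a"]
  by (auto simp flip: iter_add)

lemma shift_field_sets: "\<A> \<subseteq> sets M \<Longrightarrow> shift_field M T k \<A> \<subseteq> sets M"
  unfolding shift_field_def using iter_image[OF sets.sets_into_space] by auto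

lemma shift_field_vimage:
  assumes "\<A> \<subseteq> sets M" "B \<in> shift_field M T b \<A>"
  shows "iter M T a -` B \<inter> space M \<in> shift_field M T (b - a) \<A>"
proof -
  obtain A where A: "A \<in> \<A>" "B = iter M T b ` A" using assms(2) by (auto simp: shift_field_def)
  then have "A \<subseteq> space M" using assms(1) sets.sets_into_space by auto
  then show ?thesis using A iter_vimage_image[of A a b] by (auto simp: shift_field_def)
qed

text \<open>This is the inclusion \<open>sub\<close> moved by the power \<open>j + 1\<close> of
  \<open>T\<close>.\<close>

lemma shift_field_antimono:
  assumes A: "\<A> \<subseteq> sets M" and sub: "\<A> \<subseteq> shift_field M T (- 1) \<A>"
  shows "shift_field M T (j + 1) \<A> \<subseteq> shift_field M T j \<A>"
proof
  fix B assume "B \<in> shift_field M T (j + 1) \<A>"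
  then obtain C where C: "C \<in> \<A>" "B = iter M T (j + 1) ` C" by (auto simp: shift_field_def)
  then obtain C' where C': "C' \<in> \<A>" "C = iter M T (- 1) ` C'"
    using sub unfolding shift_field_def by blast
  have sp: "C' \<subseteq> space M" using A C'(1) sets.sets_into_space by auto
  have "iter M T (j + 1) (iter M T (- 1) x) = iter M T j x" if "x \<in> C'" for x
    using iter_add[of x "j + 1" "- 1"] sp that by (auto simp: subset_iff)
  then have "B = iter M T j ` C'"
    unfolding C C' image_image by (intro image_cong refl)
  then show "B \<in> shift_field M T j \<A>" using C' by (auto simp: shift_field_def)
qed

end

section \<open>Fields generated by shifted fields\<close>

lemma subalgebra_sigma:
  assumes "\<A> \<subseteq> sets M"
  shows "subalgebra M (sigma (space M) \<A>)"
proof -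
  have "\<A> \<subseteq> Pow (space M)" using assms sets.space_closed by blast
  then show ?thesis
    using assms sets.sigma_sets_subset[of \<A> M] by (simp add: subalgebra_def space_measure_of_conv)
qed

text \<open>\<open>obs_field\<close> and \<open>join_field\<close> are closed already, while
  \<open>cond_exp\<close> and \<open>decisions\<close> apply \<open>sigma\<close> once more; the
  second closure adds nothing.\<close>

lemma sets_sigma_sigma_sets:
  assumes "\<G> \<subseteq> Pow \<Omega>"
  shows "sets (sigma \<Omega> (sigma_sets \<Omega> \<G>)) = sigma_sets \<Omega> \<G>"
  using assms sigma_sets_into_sp[OF assms] sigma_sets_sigma_sets_eq[OF assms]
  by (subst sets_measure_of) auto

lemma measurable_sigma_sigma_sets:
  assumes G: "\<G> \<subseteq> Pow \<Omega>" and f: "f \<in> space N \<rightarrow> \<Omega>"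
    and vimage: "\<And>B. B \<in> \<G> \<Longrightarrow> f -` B \<inter> space N \<in> sets N"
  shows "f \<in> measurable N (sigma \<Omega> (sigma_sets \<Omega> \<G>))"
proof -
  have "f \<in> measurable N (sigma \<Omega> \<G>)"
    using assms by (intro measurable_measure_of)
  moreover have "sets (sigma \<Omega> (sigma_sets \<Omega> \<G>)) = sets (sigma \<Omega> \<G>)"
    using G by (simp add: sets_sigma_sigma_sets)
  ultimately show ?thesis by (subst measurable_cong_sets[OF refl])
qed

context invertible_ergodic_map
begin

lemma obs_generators: "\<A> \<subseteq> sets M \<Longrightarrow> (\<Union>k\<in>I. shift_field M T (- k) \<A>) \<subseteq> sets M"
  using shift_field_sets by blast

lemma obs_field_sets: "\<A> \<subseteq> sets M \<Longrightarrow> obs_field M T \<A> I \<subseteq> sets M"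
  unfolding obs_field_def by (intro sets.sigma_sets_subset obs_generators)

lemma join_field_sets: "\<A> \<subseteq> sets M \<Longrightarrow> \<C> \<subseteq> sets M \<Longrightarrow> join_field M \<A> \<C> \<subseteq> sets M"
  unfolding join_field_def by (intro sets.sigma_sets_subset) auto

lemma obs_field_mono: "I \<subseteq> J \<Longrightarrow> obs_field M T \<A> I \<subseteq> obs_field M T \<A> J"
  unfolding obs_field_def by (intro sigma_sets_mono') auto

lemma sets_sigma_obs_field:
  "\<A> \<subseteq> sets M \<Longrightarrow> sets (sigma (space M) (obs_field M T \<A> I)) = obs_field M T \<A> I"
  unfolding obs_field_def using obs_generators sets.space_closed by (intro sets_sigma_sigma_sets) blast

text \<open>Checked on generators: taking preimages under the power \<open>a\<close> moves the index
  \<open>j\<close> of an observation to \<open>j + a\<close>.\<close>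

lemma iter_measurable_obs_field:
  assumes A: "\<A> \<subseteq> sets M" and J: "\<And>j. j \<in> J \<Longrightarrow> j + a \<in> I"
  shows "iter M T a \<in> measurable (sigma (space M) (obs_field M T \<A> I)) (sigma (space M) (obs_field M T \<A> J))"
  unfolding obs_field_def[of _ _ _ J]
proof (rule measurable_sigma_sigma_sets)
  show "(\<Union>k\<in>J. shift_field M T (- k) \<A>) \<subseteq> Pow (space M)"
    using obs_generators[OF A, of J] sets.space_closed by blast
  show "iter M T a \<in> space (sigma (space M) (obs_field M T \<A> I)) \<rightarrow> space M"
    by (auto simp: space_measure_of_conv)
  fix B assume "B \<in> (\<Union>k\<in>J. shift_field M T (- k) \<A>)"
  then obtain j where j: "j \<in> J" "B \<in> shift_field M T (- j) \<A>" by blast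
  have "iter M T a -` B \<inter> space M \<in> shift_field M T (- (j + a)) \<A>"
    using shift_field_vimage[OF A j(2), of a] by simp
  then have "iter M T a -` B \<inter> space M \<in> obs_field M T \<A> I"
    unfolding obs_field_def using J[OF j(1)] by (intro sigma_sets.Basic) blast
  then show "iter M T a -` B \<inter> space (sigma (space M) (obs_field M T \<A> I)) \<in> sets (sigma (space M) (obs_field M T \<A> I))"
    by (simp add: sets_sigma_obs_field[OF A] space_measure_of_conv)
qed

text \<open>The sets of the shifted field are the preimages under \<open>T ^^ k\<close> of the sets
  of \<open>obs_field M T \<A> J\<close>. Invariance of the measure thus turns the integral
  identities that characterize one conditional expectation into those for the other.\<close>

lemma cond_exp_obs_field_shift:
  assumes A: "\<A> \<subseteq> sets M" and f: "integrable M f"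
  shows "AE x in M. cond_exp M (obs_field M T \<A> ((\<lambda>j. j + int k) ` J)) (\<lambda>x. f ((T ^^ k) x)) x
    = cond_exp M (obs_field M T \<A> J) f ((T ^^ k) x)"
  unfolding cond_exp_def
proof -
  let ?F = "sigma (space M) (obs_field M T \<A> J)"
  let ?G = "sigma (space M) (obs_field M T \<A> ((\<lambda>j. j + int k) ` J))"
  interpret F: sigma_finite_subalgebra M ?F
    by (intro sigma_finite_subalgebraI subalgebra_sigma obs_field_sets A)
  interpret G: sigma_finite_subalgebra M ?G
    by (intro sigma_finite_subalgebraI subalgebra_sigma obs_field_sets A)
  note [measurable] = f[THEN borel_measurable_integrable]
  have fwd: "T ^^ k \<in> measurable ?G ?F"
    using iter_measurable_obs_field[OF A, of J "int k" "(\<lambda>j. j + int k) ` J"] by (simp add: iter_nat)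
  have bwd: "iter M T (- int k) \<in> measurable ?F ?G"
    by (intro iter_measurable_obs_field A) auto
  show "AE x in M. real_cond_exp M ?G (\<lambda>x. f ((T ^^ k) x)) x = real_cond_exp M ?F f ((T ^^ k) x)"
  proof (rule G.real_cond_exp_charact)
    show "integrable M (\<lambda>x. f ((T ^^ k) x))" by (rule integrable_funpow[OF f])
    show "integrable M (\<lambda>x. real_cond_exp M ?F f ((T ^^ k) x))"
      by (intro integrable_funpow F.real_cond_exp_int f)
    show "(\<lambda>x. real_cond_exp M ?F f ((T ^^ k) x)) \<in> borel_measurable ?G"
      using measurable_comp[OF fwd borel_measurable_cond_exp] by (simp add: comp_def)
    fix B assume B: "B \<in> sets ?G"
    define C where "C = iter M T (- int k) -` B \<inter> space M"
    have C: "C \<in> sets ?F" unfolding C_def using measurable_sets[OF bwd B] by (simp add: space_measure_of_conv)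
    have [measurable]: "C \<in> sets M" using C F.subalg by (auto simp: subalgebra_def)
    have BC: "x \<in> B \<longleftrightarrow> (T ^^ k) x \<in> C" if "x \<in> space M" for x
      using that iter_space[OF that, of "int k"] unfolding C_def iter_nat[symmetric]
      by (auto simp flip: iter_add)
    have transfer: "(\<integral>x\<in>B. g ((T ^^ k) x) \<partial>M) = (\<integral>x\<in>C. g x \<partial>M)" if [measurable]: "g \<in> borel_measurable M" for g :: "'a \<Rightarrow> real"
    proof -
      have "(\<integral>x\<in>B. g ((T ^^ k) x) \<partial>M) = (\<integral>x. indicator C ((T ^^ k) x) * g ((T ^^ k) x) \<partial>M)"
        unfolding set_lebesgue_integral_def
        by (rule Bochner_Integration.integral_cong) (auto simp: BC indicator_def)
      also have "\<dots> = (\<integral>x\<in>C. g x \<partial>M)"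
        unfolding set_lebesgue_integral_def using integral_funpow[of "\<lambda>x. indicator C x * g x" k] by simp
      finally show ?thesis .
    qed
    show "(\<integral>x\<in>B. f ((T ^^ k) x) \<partial>M) = (\<integral>x\<in>B. real_cond_exp M ?F f ((T ^^ k) x) \<partial>M)"
      using F.real_cond_exp_intA[OF f C] by (simp add: transfer)
  qed
qed

end

section \<open>Time averages of the loss\<close>

locale decision_problem = invertible_ergodic_map M T
  for M :: "'a measure" and T :: "'a \<Rightarrow> 'a" +
  fixes \<Y> :: "'a set set" and D :: "'u measure" and l :: "'u \<Rightarrow> 'a \<Rightarrow> real" and \<Lambda> :: "'a \<Rightarrow> real"
  assumes \<Y>_sets: "\<Y> \<subseteq> sets M"
    and l_measurable [measurable]: "(\<lambda>(u, \<omega>). l u \<omega>) \<in> borel_measurable (D \<Otimes>\<^sub>M M)"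
    and \<Lambda>_integrable: "integrable M \<Lambda>"
    and l_bound: "\<And>u \<omega>. u \<in> space D \<Longrightarrow> \<omega> \<in> space M \<Longrightarrow> \<bar>l u \<omega>\<bar> \<le> \<Lambda> \<omega>"
begin

abbreviation "obs \<equiv> obs_field M T \<Y>"
abbreviation "loss \<equiv> loss_at M T l 0"
abbreviation "\<D> \<equiv> decisions M T \<Y> D"
abbreviation "\<D>\<^sub>0 \<equiv> decisions_upto M T \<Y> D 0"

lemma obs_sets: "obs I \<subseteq> sets M"
  by (rule obs_field_sets[OF \<Y>_sets])

lemma decisions_measurable: "v \<in> \<D> m n \<Longrightarrow> v \<in> measurable M D"
  unfolding decisions_def by (rule measurable_from_subalg[OF subalgebra_sigma[OF obs_sets]])

lemma decisions_upto_measurable: "v \<in> \<D>\<^sub>0 \<Longrightarrow> v \<in> measurable M D"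
  unfolding decisions_upto_def using decisions_measurable by blast

lemma decisions_mono: "m' \<le> m \<Longrightarrow> \<D> m n \<subseteq> \<D> m' n"
  unfolding decisions_def
  by (rule measurable_mono)
    (auto simp: space_measure_of_conv sets_sigma_obs_field[OF \<Y>_sets] intro: obs_field_mono[THEN subsetD, rotated])

lemma decisions_subset_upto: "m \<le> 0 \<Longrightarrow> \<D> m 0 \<subseteq> \<D>\<^sub>0"
  unfolding decisions_upto_def by blast

lemma decisions_shift:
  assumes "v \<in> \<D> m n"
  shows "(\<lambda>x. v (iter M T a x)) \<in> \<D> (m + a) (n + a)"
  using measurable_comp[OF iter_measurable_obs_field[OF \<Y>_sets, of "{m..n}" a "{m + a..n + a}"]] assms
  unfolding decisions_def by (auto simp: comp_def)

lemma loss_measurable: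
  assumes [measurable]: "v \<in> measurable M D"
  shows "loss_at M T l n v \<in> borel_measurable M"
proof -
  have "(\<lambda>x. (v x, iter M T n x)) \<in> measurable M (D \<Otimes>\<^sub>M M)" by measurable
  from measurable_comp[OF this l_measurable] show ?thesis
    by (simp add: comp_def loss_at_def[abs_def])
qed

lemma loss_bound: "v \<in> measurable M D \<Longrightarrow> x \<in> space M \<Longrightarrow> \<bar>loss v x\<bar> \<le> \<Lambda> x"
  unfolding loss_at_def using l_bound[OF measurable_space] by simp

lemma loss_integrable:
  assumes "v \<in> measurable M D"
  shows "integrable M (loss v)"
  by (rule Bochner_Integration.integrable_bound[OF \<Lambda>_integrable loss_measurable[OF assms]])
    (use loss_bound[OF assms] in \<open>simp add: order_trans[OF _ abs_ge_self]\<close>)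

lemma loss_shift:
  "x \<in> space M \<Longrightarrow> loss (\<lambda>x. v (iter M T (- int k) x)) ((T ^^ k) x) = loss_at M T l (int k) v x"
  by (simp add: loss_at_def flip: iter_nat) (simp flip: iter_add)

lemma cond_exp_measurable: "cond_exp M \<A> f \<in> borel_measurable M"
  unfolding cond_exp_def by simp

lemma cond_exp_integrable:
  assumes "\<A> \<subseteq> sets M" "integrable M f"
  shows "integrable M (cond_exp M \<A> f)"
  unfolding cond_exp_def
  by (intro sigma_finite_subalgebra.real_cond_exp_int sigma_finite_subalgebraI subalgebra_sigma assms)

lemma cond_exp_loss_bound:
  assumes "\<A> \<subseteq> sets M" "v \<in> measurable M D"
  shows "AE x in M. \<bar>cond_exp M \<A> (loss v) x\<bar> \<le> cond_exp M \<A> \<Lambda> x"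
  unfolding cond_exp_def
  using loss_bound[OF assms(2)]
  by (intro real_cond_exp_abs_le subalgebra_sigma assms loss_integrable \<Lambda>_integrable) auto

section \<open>The fields \<open>H\<^sub>j\<close> and the strong law for the losses\<close>

definition enriched_past :: "'a set set \<Rightarrow> int \<Rightarrow> 'a set set" where
  "enriched_past \<X> j = join_field M (obs {..0}) (shift_field M T j \<X>)"

lemma enriched_past_sets: "\<X> \<subseteq> sets M \<Longrightarrow> enriched_past \<X> j \<subseteq> sets M"
  unfolding enriched_past_def by (intro join_field_sets obs_sets shift_field_sets)

lemma sets_sigma_enriched_past:
  assumes "\<X> \<subseteq> sets M"
  shows "sets (sigma (space M) (enriched_past \<X> j)) = enriched_past \<X> j"
  unfolding enriched_past_def join_field_def
  using obs_sets shift_field_sets[OF assms] sets.space_closed by (intro sets_sigma_sigma_sets) blast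

text \<open>Supplies the hypothesis on \<open>\<tau>\<close> in the strong law for increments, with
  \<open>H\<^sub>j\<^sub>+\<^sub>1\<close> as \<open>F\<close> and \<open>H\<^sub>j\<close> as
  \<open>G\<close>. Preimages under the inverse of \<open>T\<close> raise the index of
  \<open>T\<^sup>j\<X>\<close> by one and move past observations further into the past.\<close>

lemma inverse_measurable_enriched_past:
  assumes X: "\<X> \<subseteq> sets M"
  shows "iter M T (- 1) \<in> measurable (sigma (space M) (enriched_past \<X> (j + 1))) (sigma (space M) (enriched_past \<X> j))"
  unfolding enriched_past_def[of _ j] join_field_def
proof (rule measurable_sigma_sigma_sets)
  show "obs {..0} \<union> shift_field M T j \<X> \<subseteq> Pow (space M)"
    using obs_sets shift_field_sets[OF X] sets.space_closed by blast
  show "iter M T (- 1) \<in> space (sigma (space M) (enriched_past \<X> (j + 1))) \<rightarrow> space M"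
    by (auto simp: space_measure_of_conv)
  fix B assume B: "B \<in> obs {..0} \<union> shift_field M T j \<X>"
  have "iter M T (- 1) -` B \<inter> space M \<in> obs {..0} \<union> shift_field M T (j + 1) \<X>"
  proof (cases "B \<in> obs {..0}")
    case True
    have "iter M T (- 1) \<in> measurable (sigma (space M) (obs {..0})) (sigma (space M) (obs {..0}))"
      by (intro iter_measurable_obs_field \<Y>_sets) auto
    from measurable_sets[OF this, of B] True show ?thesis
      by (simp add: sets_sigma_obs_field[OF \<Y>_sets] space_measure_of_conv)
  next
    case False
    then show ?thesis using B shift_field_vimage[OF X, of B j "- 1"] by simp
  qed
  then have "iter M T (- 1) -` B \<inter> space M \<in> enriched_past \<X> (j + 1)"
    unfolding enriched_past_def join_field_def by (rule sigma_sets.Basic)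
  then show "iter M T (- 1) -` B \<inter> space (sigma (space M) (enriched_past \<X> (j + 1)))
      \<in> sets (sigma (space M) (enriched_past \<X> (j + 1)))"
    by (simp add: sets_sigma_enriched_past[OF X] space_measure_of_conv)
qed

text \<open>The difference telescopes into \<open>p\<close> differences between consecutive fields,
  and each of them obeys the law for increments with \<open>\<tau>\<close> the inverse of
  \<open>T\<close>.\<close>

lemma enriched_past_increments_strong_law:
  assumes X: "\<X> \<subseteq> sets M" and sub: "\<X> \<subseteq> shift_field M T (- 1) \<X>"
    and v: "\<And>k. v k \<in> measurable M D"
  shows "AE x in M. (\<lambda>N. cesaro (\<lambda>k x. cond_exp M (enriched_past \<X> j) (loss (v k)) x
      - cond_exp M (enriched_past \<X> (j + int p)) (loss (v k)) x) N x) \<longlonglongrightarrow> 0"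
proof (induction p)
  case 0
  then show ?case by (simp add: cesaro_def)
next
  case (Suc p)
  let ?H = "\<lambda>j. sigma (space M) (enriched_past \<X> j)"
  define j' where "j' = j + int p"
  have "AE x in M. (\<lambda>N. cesaro (\<lambda>k x. real_cond_exp M (?H j') (loss (v k)) x
      - real_cond_exp M (?H (j' + 1)) (loss (v k)) x) N x) \<longlonglongrightarrow> 0"
  proof (rule cond_exp_increments_strong_law)
    show "subalgebra M (?H j')" by (intro subalgebra_sigma enriched_past_sets X)
    have "enriched_past \<X> (j' + 1) \<subseteq> enriched_past \<X> j'"
      unfolding enriched_past_def join_field_def
      using shift_field_antimono[OF X sub, of j'] by (intro sigma_sets_mono') auto
    then show "subalgebra (?H j') (?H (j' + 1))"
      by (simp add: subalgebra_def space_measure_of_conv sets_sigma_enriched_past[OF X])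
    show "iter M T (- 1) \<in> measurable (?H (j' + 1)) (?H j')"
      by (rule inverse_measurable_enriched_past[OF X])
    show "iter M T (- 1) (T x) = x" if "x \<in> space M" for x
      using inv_T[OF that] by (simp add: iter_def)
    show "integrable M \<Lambda>" by (rule \<Lambda>_integrable)
    show "loss (v k) \<in> borel_measurable M" for k by (rule loss_measurable[OF v])
    show "\<bar>loss (v k) x\<bar> \<le> \<Lambda> x" if "x \<in> space M" for k x by (rule loss_bound[OF v that])
  qed
  with Suc show ?case
  proof eventually_elim
    case (elim x)
    from tendsto_add[OF elim] show ?case
      by (simp add: cond_exp_def j'_def algebra_simps flip: cesaro_add)
  qed
qed

text \<open>The difference splits into an error at \<open>H\<^sub>-\<^sub>n\<close>, the increments
  from \<open>-n\<close> to \<open>n\<close>, and an error at \<open>H\<^sub>n\<close>, where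
  \<open>remote\<close> exchanges \<open>\<R>\<close> for the observed past. The essential suprema
  bound both errors uniformly in \<open>k\<close>.\<close>

lemma loss_strong_law:
  assumes X: "\<X> \<subseteq> sets M" and sub: "\<X> \<subseteq> shift_field M T (- 1) \<X>"
    and future: "L1_tendsto_zero M (\<lambda>n. ess_sup M \<D>\<^sub>0 (\<lambda>u x.
        \<bar>cond_exp M (enriched_past \<X> (- int n)) (loss u) x - loss u x\<bar>))"
    and past: "L1_tendsto_zero M (\<lambda>n. ess_sup M \<D>\<^sub>0 (\<lambda>u x.
        \<bar>cond_exp M (enriched_past \<X> (int n)) (loss u) x - cond_exp M \<R> (loss u) x\<bar>))"
    and remote: "\<And>u. u \<in> \<D>\<^sub>0 \<Longrightarrow>
        AE x in M. cond_exp M (obs {..0}) (loss u) x = cond_exp M \<R> (loss u) x"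
    and v: "\<And>k. v k \<in> \<D>\<^sub>0"
  shows "AE x in M. (\<lambda>N. cesaro (\<lambda>k x. loss (v k) x - cond_exp M (obs {..0}) (loss (v k)) x) N x) \<longlonglongrightarrow> 0"
proof (rule cesaro_approx)
  fix e :: real assume e: "0 < e"
  have vm: "v k \<in> measurable M D" for k by (rule decisions_upto_measurable[OF v])
  define f where "f = (\<lambda>n u x. \<bar>cond_exp M (enriched_past \<X> (- int n)) (loss u) x - loss u x\<bar>)"
  define p where "p = (\<lambda>n u x. \<bar>cond_exp M (enriched_past \<X> (int n)) (loss u) x - cond_exp M \<R> (loss u) x\<bar>)"
  have f_sup: "is_ess_sup M \<D>\<^sub>0 (f n) (ess_sup M \<D>\<^sub>0 (f n))" for n
    unfolding f_def by (intro is_ess_sup_ess_sup borel_measurable_abs borel_measurable_diff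
        cond_exp_measurable loss_measurable decisions_upto_measurable)
  have p_sup: "is_ess_sup M \<D>\<^sub>0 (p n) (ess_sup M \<D>\<^sub>0 (p n))" for n
    unfolding p_def by (intro is_ess_sup_ess_sup borel_measurable_abs borel_measurable_diff
        cond_exp_measurable)
  have fut: "L1_tendsto_zero M (\<lambda>n. ess_sup M \<D>\<^sub>0 (f n))"
    using future by (simp add: f_def)
  have pas: "L1_tendsto_zero M (\<lambda>n. ess_sup M \<D>\<^sub>0 (p n))"
    using past by (simp add: p_def)
  \<comment> \<open>Both errors have to be small for the same \<open>n\<close>.\<close>
  have "eventually (\<lambda>n. (\<exists>g. integrable M g \<and> (\<integral>x. g x \<partial>M) < e / 2 \<and>
        (AE x in M. \<forall>r. ereal r \<le> ess_sup M \<D>\<^sub>0 (f n) x \<longrightarrow> r \<le> g x)) \<and>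
      (\<exists>g. integrable M g \<and> (\<integral>x. g x \<partial>M) < e / 2 \<and>
        (AE x in M. \<forall>r. ereal r \<le> ess_sup M \<D>\<^sub>0 (p n) x \<longrightarrow> r \<le> g x))) sequentially"
    using e f_sup p_sup fut pas
    by (intro eventually_conj L1_tendsto_zero_dominating) (simp_all add: is_ess_sup_def)
  then obtain n g g' where g: "integrable M g" "(\<integral>x. g x \<partial>M) < e / 2"
      "AE x in M. \<forall>r. ereal r \<le> ess_sup M \<D>\<^sub>0 (f n) x \<longrightarrow> r \<le> g x"
    and g': "integrable M g'" "(\<integral>x. g' x \<partial>M) < e / 2"
      "AE x in M. \<forall>r. ereal r \<le> ess_sup M \<D>\<^sub>0 (p n) x \<longrightarrow> r \<le> g' x"
    unfolding eventually_sequentially by blast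
  define b where "b = (\<lambda>k x. cond_exp M (enriched_past \<X> (- int n)) (loss (v k)) x
      - cond_exp M (enriched_past \<X> (int n)) (loss (v k)) x)"
  show "\<exists>g b. integrable M g \<and> (\<integral>x. g x \<partial>M) < e \<and> (AE x in M. (\<lambda>N. cesaro b N x) \<longlonglongrightarrow> 0) \<and>
    (\<forall>k\<ge>1. AE x in M. \<bar>loss (v k) x - cond_exp M (obs {..0}) (loss (v k)) x - b k x\<bar> \<le> g x)"
  proof (intro exI conjI allI impI)
    show "integrable M (\<lambda>x. g x + g' x)" "(\<integral>x. g x + g' x \<partial>M) < e"
      using g g' by auto
    \<comment> \<open>Taking \<open>p = 2 * n\<close> steps leads from \<open>- int n\<close> to
      \<open>int n\<close>.\<close>
    show "AE x in M. (\<lambda>N. cesaro b N x) \<longlonglongrightarrow> 0"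
      using enriched_past_increments_strong_law[OF X sub vm, where j = "- int n" and p = "2 * n"] by (simp add: b_def)
    fix k
    have "AE x in M. ereal (f n (v k) x) \<le> ess_sup M \<D>\<^sub>0 (f n) x"
      "AE x in M. ereal (p n (v k) x) \<le> ess_sup M \<D>\<^sub>0 (p n) x"
      using f_sup[of n] p_sup[of n] v[of k] unfolding is_ess_sup_def by auto
    with g(3) g'(3) remote[OF v[of k]]
    show "AE x in M. \<bar>loss (v k) x - cond_exp M (obs {..0}) (loss (v k)) x - b k x\<bar> \<le> g x + g' x"
    proof eventually_elim
      case (elim x)
      then have "f n (v k) x \<le> g x" "p n (v k) x \<le> g' x" by auto
      then show ?case using elim(3) by (simp add: f_def p_def b_def)
    qed
  qed
qed

section \<open>The essential infimum and asymptotic optimality\<close>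

definition ess_inf_loss :: "'a \<Rightarrow> ereal" where
  "ess_inf_loss = ess_inf M \<D>\<^sub>0 (\<lambda>u. cond_exp M (obs {..0}) (loss u))"

lemma is_ess_inf_loss: "is_ess_inf M \<D>\<^sub>0 (\<lambda>u. cond_exp M (obs {..0}) (loss u)) ess_inf_loss"
  unfolding ess_inf_loss_def by (intro is_ess_inf_ess_inf cond_exp_measurable)

lemma ess_inf_loss_measurable [measurable]: "ess_inf_loss \<in> borel_measurable M"
  using is_ess_inf_loss by (simp add: is_ess_inf_def)

lemma ess_inf_loss_lower:
  "u \<in> \<D>\<^sub>0 \<Longrightarrow> AE x in M. ess_inf_loss x \<le> ereal (cond_exp M (obs {..0}) (loss u) x)"
  using is_ess_inf_loss by (simp add: is_ess_inf_def)

lemma ess_inf_loss_greatest: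
  assumes "Z \<in> borel_measurable M"
    and "\<And>u. u \<in> \<D>\<^sub>0 \<Longrightarrow> AE x in M. Z x \<le> ereal (cond_exp M (obs {..0}) (loss u) x)"
  shows "AE x in M. Z x \<le> ess_inf_loss x"
  using is_ess_inf_loss assms unfolding is_ess_inf_def by blast

text \<open>Any single decision gives the upper bound; the lower one holds because
  \<open>- cond_exp M (obs {..0}) \<Lambda> x\<close> is a lower bound of the family. For empty
  \<open>\<D>\<^sub>0\<close> the essential infimum would be infinite.\<close>

lemma ess_inf_loss_bound:
  assumes "\<D>\<^sub>0 \<noteq> {}"
  shows "AE x in M. ereal (real_of_ereal (ess_inf_loss x)) = ess_inf_loss x \<and>
    \<bar>real_of_ereal (ess_inf_loss x)\<bar> \<le> cond_exp M (obs {..0}) \<Lambda> x"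
proof -
  note [measurable] = cond_exp_measurable
  obtain u where u: "u \<in> \<D>\<^sub>0" using assms by blast
  have bound: "AE x in M. \<bar>cond_exp M (obs {..0}) (loss w) x\<bar> \<le> cond_exp M (obs {..0}) \<Lambda> x" if "w \<in> \<D>\<^sub>0" for w
    using that by (intro cond_exp_loss_bound obs_sets decisions_upto_measurable)
  have "AE x in M. ereal (- cond_exp M (obs {..0}) \<Lambda> x) \<le> ess_inf_loss x"
  proof (rule ess_inf_loss_greatest)
    fix w assume "w \<in> \<D>\<^sub>0"
    from bound[OF this] show "AE x in M. ereal (- cond_exp M (obs {..0}) \<Lambda> x) \<le> ereal (cond_exp M (obs {..0}) (loss w) x)"
      by eventually_elim auto
  qed simp
  with bound[OF u] ess_inf_loss_lower[OF u] show ?thesis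
  proof eventually_elim
    case (elim x)
    then show ?case by (cases "ess_inf_loss x") auto
  qed
qed

text \<open>The decision \<open>w\<close> depends on a bounded stretch of the past, so for large
  \<open>k\<close> it competes with \<open>v k\<close>. Passing from \<open>obs {- int k..0}\<close>
  to \<open>obs {..0}\<close> costs at most the essential supremum for \<open>k\<close>, once for
  \<open>v k\<close> and once for \<open>w\<close>.\<close>

lemma Limsup_loss_le:
  assumes v: "\<And>k. k \<ge> 1 \<Longrightarrow> v k \<in> \<D> (- int k) 0"
    and opt: "\<And>k w. k \<ge> 1 \<Longrightarrow> w \<in> \<D> (- int k) 0 \<Longrightarrow> AE x in M.
      cond_exp M (obs {- int k..0}) (loss (v k)) x \<le> cond_exp M (obs {- int k..0}) (loss w) x + 1 / real k"
    and conv: "AE x in M. (\<lambda>n. ess_sup M (\<D> (- int n) 0) (\<lambda>u x.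
      \<bar>cond_exp M (obs {- int n..0}) (loss u) x - cond_exp M (obs {..0}) (loss u) x\<bar>) x) \<longlonglongrightarrow> 0"
    and w: "w \<in> \<D>\<^sub>0"
  shows "AE x in M. limsup (\<lambda>k. ereal (cond_exp M (obs {..0}) (loss (v k)) x))
    \<le> ereal (cond_exp M (obs {..0}) (loss w) x)"
proof -
  define c where "c = (\<lambda>n u x. \<bar>cond_exp M (obs {- int n..0}) (loss u) x - cond_exp M (obs {..0}) (loss u) x\<bar>)"
  define C where "C = (\<lambda>n. ess_sup M (\<D> (- int n) 0) (c n))"
  have C: "is_ess_sup M (\<D> (- int n) 0) (c n) (C n)" for n
    unfolding C_def c_def by (intro is_ess_sup_ess_sup borel_measurable_abs borel_measurable_diff cond_exp_measurable)
  have C_ge: "AE x in M. ereal (c n u x) \<le> C n x" if "u \<in> \<D> (- int n) 0" for n u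
    using C[of n] that by (simp add: is_ess_sup_def)
  have C_lim: "AE x in M. (\<lambda>n. C n x) \<longlonglongrightarrow> 0"
    using conv unfolding C_def c_def .
  obtain m' where m': "m' \<le> 0" "w \<in> \<D> m' 0" using w unfolding decisions_upto_def by auto
  \<comment> \<open>From \<open>m\<close> on, \<open>w\<close> belongs to
    \<open>\<D> (- int k) 0\<close>, and \<open>k \<ge> 1\<close> holds as well.\<close>
  define m where "m = max 1 (nat (- m'))"
  have wk: "w \<in> \<D> (- int k) 0" if "k \<ge> m" for k
  proof -
    have "- int k \<le> m'" using m'(1) that by (simp add: m_def nat_le_iff)
    from decisions_mono[OF this, of 0] m'(2) show ?thesis by blast
  qed
  have "AE x in M. k \<ge> m \<longrightarrow> ereal (c k (v k) x) \<le> C k x \<and> ereal (c k w x) \<le> C k x \<and>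
      cond_exp M (obs {- int k..0}) (loss (v k)) x \<le> cond_exp M (obs {- int k..0}) (loss w) x + 1 / real k" for k
  proof (cases "k \<ge> m")
    case True
    then have "k \<ge> 1" by (simp add: m_def)
    from C_ge[OF v[OF this]] C_ge[OF wk[OF True]] opt[OF this wk[OF True]] show ?thesis
      by eventually_elim simp
  qed simp
  then have "AE x in M. \<forall>k. k \<ge> m \<longrightarrow> ereal (c k (v k) x) \<le> C k x \<and> ereal (c k w x) \<le> C k x \<and>
      cond_exp M (obs {- int k..0}) (loss (v k)) x \<le> cond_exp M (obs {- int k..0}) (loss w) x + 1 / real k"
    by (simp only: AE_all_countable) simp
  with C_lim show ?thesis
  proof eventually_elim
    case (elim x)
    show ?case
    proof (rule ereal_le_epsilon2)
      fix e :: real assume e: "0 < e"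
      \<comment> \<open>Three errors share \<open>e\<close>: the two changes of field and the
        tolerance \<open>1 / real k\<close>.\<close>
      have "eventually (\<lambda>k. C k x < ereal (e / 3)) sequentially"
        using e by (intro order_tendstoD(2)[OF elim(1)]) simp
      moreover have "eventually (\<lambda>k. 1 / real k < e / 3) sequentially"
        using e by (intro order_tendstoD(2)[OF lim_1_over_n]) simp
      ultimately have "eventually (\<lambda>k. ereal (cond_exp M (obs {..0}) (loss (v k)) x)
          \<le> ereal (cond_exp M (obs {..0}) (loss w) x) + ereal e) sequentially"
        using eventually_ge_at_top[of m]
      proof eventually_elim
        case (elim k)
        note k = \<open>\<forall>k. k \<ge> m \<longrightarrow> _ k\<close>[rule_format, OF elim(3)]
        have "ereal (c k (v k) x) < ereal (e / 3)" "ereal (c k w x) < ereal (e / 3)"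
          using k elim(1) le_less_trans by blast+
        then have "c k (v k) x < e / 3" "c k w x < e / 3" by simp_all
        then have "cond_exp M (obs {..0}) (loss (v k)) x \<le> cond_exp M (obs {..0}) (loss w) x + e"
          using k elim(2) unfolding c_def by linarith
        then show ?case by simp
      qed
      then show "limsup (\<lambda>k. ereal (cond_exp M (obs {..0}) (loss (v k)) x))
          \<le> ereal (cond_exp M (obs {..0}) (loss w) x) + ereal e"
        by (rule Limsup_bounded)
    qed
  qed
qed

text \<open>The limit superior is a measurable lower bound of the family, hence at most the
  essential infimum; conversely, almost surely every term lies above the essential infimum.\<close>

lemma near_optimal_loss_tendsto:
  assumes v: "\<And>k. v k \<in> \<D>\<^sub>0"
    and limsup: "\<And>w. w \<in> \<D>\<^sub>0 \<Longrightarrow> AE x in M. limsup (\<lambda>k. ereal (cond_exp M (obs {..0}) (loss (v k)) x))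
      \<le> ereal (cond_exp M (obs {..0}) (loss w) x)"
  shows "AE x in M. (\<lambda>k. cond_exp M (obs {..0}) (loss (v k)) x) \<longlonglongrightarrow> real_of_ereal (ess_inf_loss x)"
proof -
  note [measurable] = cond_exp_measurable
  have "AE x in M. limsup (\<lambda>k. ereal (cond_exp M (obs {..0}) (loss (v k)) x)) \<le> ess_inf_loss x"
    using limsup by (intro ess_inf_loss_greatest) auto
  moreover have "AE x in M. \<forall>k. ess_inf_loss x \<le> ereal (cond_exp M (obs {..0}) (loss (v k)) x)"
    unfolding AE_all_countable using ess_inf_loss_lower[OF v] by blast
  moreover have "\<D>\<^sub>0 \<noteq> {}" using v by auto
  then have "AE x in M. ereal (real_of_ereal (ess_inf_loss x)) = ess_inf_loss x \<and>
    \<bar>real_of_ereal (ess_inf_loss x)\<bar> \<le> cond_exp M (obs {..0}) \<Lambda> x"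
    by (rule ess_inf_loss_bound)
  ultimately show ?thesis
  proof eventually_elim
    case (elim x)
    define J where "J = real_of_ereal (ess_inf_loss x)"
    have J: "ess_inf_loss x = ereal J" using elim(3) by (simp add: J_def)
    show ?case
      unfolding J_def[symmetric]
    proof (rule order_tendstoI)
      fix a assume "a < J"
      then show "eventually (\<lambda>k. a < cond_exp M (obs {..0}) (loss (v k)) x) sequentially"
        using elim(2) unfolding J by (intro always_eventually allI) (auto intro: less_le_trans)
    next
      fix a assume "J < a"
      then have "limsup (\<lambda>k. ereal (cond_exp M (obs {..0}) (loss (v k)) x)) < ereal a"
        using elim(1) unfolding J by (auto intro: le_less_trans)
      from Limsup_lessD[OF this] show "eventually (\<lambda>k. cond_exp M (obs {..0}) (loss (v k)) x < a) sequentially"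
        by simp
    qed
  qed
qed

text \<open>The strategy as seen from time \<open>0\<close>. Admissibility says nothing about the
  entry \<open>u 0\<close>; with \<open>max 1 k\<close> the first entry is repeated there, and an
  admissible \<open>u\<close> yields a decision in \<open>\<D>\<^sub>0\<close> for every
  index.\<close>

definition recentred :: "(nat \<Rightarrow> 'a \<Rightarrow> 'u) \<Rightarrow> nat \<Rightarrow> 'a \<Rightarrow> 'u" where
  "recentred u k x = u (max 1 k) (iter M T (- int (max 1 k)) x)"

section \<open>Recentred strategies and their time averages\<close>

lemma recentred_decisions:
  assumes "admissible M T \<Y> D u"
  shows "recentred u k \<in> \<D> (- int (max 1 k)) 0"
  using assms decisions_shift[of "u (max 1 k)" 0 "int (max 1 k)" "- int (max 1 k)"]
  unfolding admissible_def recentred_def[abs_def] by simp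

lemma recentred_decisions_upto: "admissible M T \<Y> D u \<Longrightarrow> recentred u k \<in> \<D>\<^sub>0"
  using recentred_decisions decisions_subset_upto[of "- int (max 1 k)"] by auto

lemma loss_recentred:
  "k \<ge> 1 \<Longrightarrow> x \<in> space M \<Longrightarrow> loss (recentred u k) ((T ^^ k) x) = loss_at M T l (int k) (u k) x"
  using loss_shift[of x "u k" k] by (simp add: recentred_def[abs_def] max_def)

lemma avg_loss_eq_cesaro:
  "x \<in> space M \<Longrightarrow> avg_loss M T l N u x = cesaro (\<lambda>k. loss (recentred u k)) N x"
  by (simp add: avg_loss_def cesaro_def loss_recentred)

text \<open>A competitor \<open>w\<close> at time \<open>0\<close> becomes the competitor
  \<open>?w\<close> at time \<open>k\<close>. As conditional expectations commute with the shift,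
  near-optimality of \<open>u k\<close> against \<open>?w\<close> is the claim at the point
  \<open>(T ^^ k) x\<close>.\<close>

lemma recentred_mean_optimal:
  assumes opt: "mean_optimal M T \<Y> D l u" and k: "k \<ge> 1" and w: "w \<in> \<D> (- int k) 0"
  shows "AE x in M. cond_exp M (obs {- int k..0}) (loss (recentred u k)) x
    \<le> cond_exp M (obs {- int k..0}) (loss w) x + 1 / real k"
proof -
  note [measurable] = cond_exp_measurable
  have adm: "admissible M T \<Y> D u" using opt by (simp add: mean_optimal_def)
  let ?w = "\<lambda>x. w (iter M T (int k) x)"
  have w': "?w \<in> \<D> 0 (int k)" using decisions_shift[OF w, of "int k"] by simp
  have uk: "u k \<in> \<D> 0 (int k)" using adm k by (simp add: admissible_def)
  have image: "(\<lambda>j. j + int k) ` {- int k..0} = {0..int k}"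
    by (auto simp: image_iff intro!: bexI[of _ "_ - int k"])
  have shift: "AE x in M. cond_exp M (obs {0..int k}) (\<lambda>x. f ((T ^^ k) x)) x
      = cond_exp M (obs {- int k..0}) f ((T ^^ k) x)" if "integrable M f" for f
    using cond_exp_obs_field_shift[OF \<Y>_sets that, of k "{- int k..0}"] by (simp only: image)
  have rm: "recentred u k \<in> measurable M D"
    by (rule decisions_measurable[OF recentred_decisions[OF adm]])
  \<comment> \<open>The two losses are compared on \<open>space M\<close> only, hence a congruence
    almost everywhere.\<close>
  have "AE x in M. cond_exp M (obs {0..int k}) (loss_at M T l (int k) (u k)) x
      = cond_exp M (obs {0..int k}) (\<lambda>x. loss (recentred u k) ((T ^^ k) x)) x"
    unfolding cond_exp_def
  proof (rule sigma_finite_subalgebra.real_cond_exp_cong)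
    show "sigma_finite_subalgebra M (sigma (space M) (obs {0..int k}))"
      by (intro sigma_finite_subalgebraI subalgebra_sigma obs_sets)
    show "AE x in M. loss_at M T l (int k) (u k) x = loss (recentred u k) ((T ^^ k) x)"
      by (intro AE_I2) (simp add: loss_recentred[OF k])
    show "loss_at M T l (int k) (u k) \<in> borel_measurable M"
      by (intro loss_measurable decisions_measurable[OF uk])
    show "(\<lambda>x. loss (recentred u k) ((T ^^ k) x)) \<in> borel_measurable M"
      using loss_measurable[OF rm, of 0] by measurable
  qed
  moreover note shift[OF loss_integrable[OF rm]]
  moreover have "loss_at M T l (int k) ?w = (\<lambda>x. loss w ((T ^^ k) x))"
    by (simp add: loss_at_def[abs_def] iter_nat)
  with shift[OF loss_integrable[OF decisions_measurable[OF w]]]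
  have "AE x in M. cond_exp M (obs {0..int k}) (loss_at M T l (int k) ?w) x
      = cond_exp M (obs {- int k..0}) (loss w) ((T ^^ k) x)" by simp
  moreover have "AE x in M. ess_inf M (\<D> 0 (int k)) (\<lambda>v. cond_exp M (obs {0..int k}) (loss_at M T l (int k) v)) x
      \<le> ereal (cond_exp M (obs {0..int k}) (loss_at M T l (int k) ?w) x)"
    using is_ess_inf_ess_inf[of "\<D> 0 (int k)" "\<lambda>v. cond_exp M (obs {0..int k}) (loss_at M T l (int k) v)"] w'
    unfolding is_ess_inf_def by (auto simp: cond_exp_measurable)
  moreover have "AE x in M. ereal (cond_exp M (obs {0..int k}) (loss_at M T l (int k) (u k)) x)
      \<le> ess_inf M (\<D> 0 (int k)) (\<lambda>v. cond_exp M (obs {0..int k}) (loss_at M T l (int k) v)) x + ereal (1 / real k)"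
    using opt k unfolding mean_optimal_def by blast
  ultimately have "AE x in M. cond_exp M (obs {- int k..0}) (loss (recentred u k)) ((T ^^ k) x)
    \<le> cond_exp M (obs {- int k..0}) (loss w) ((T ^^ k) x) + 1 / real k"
  proof eventually_elim
    case (elim x)
    have "ereal (cond_exp M (obs {0..int k}) (loss_at M T l (int k) (u k)) x)
      \<le> ereal (cond_exp M (obs {0..int k}) (loss_at M T l (int k) ?w) x) + ereal (1 / real k)"
      using elim(4,5) by (meson add_right_mono order_trans)
    then show ?case using elim(1,2,3) by simp
  qed
  then show ?thesis by (subst (asm) AE_funpow_iff) auto
qed

text \<open>The strong law enters as the hypothesis \<open>law\<close>, for every admissible
  strategy, because the second claim compares with arbitrary ones.\<close>

lemma mean_optimal_avg_loss:
  assumes opt: "mean_optimal M T \<Y> D l u_opt"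
    and law: "\<And>u. admissible M T \<Y> D u \<Longrightarrow> AE x in M. (\<lambda>N. cesaro (\<lambda>k x.
      loss (recentred u k) x - cond_exp M (obs {..0}) (loss (recentred u k)) x) N x) \<longlonglongrightarrow> 0"
    and conv: "AE x in M. (\<lambda>n. ess_sup M (\<D> (- int n) 0) (\<lambda>u x.
      \<bar>cond_exp M (obs {- int n..0}) (loss u) x - cond_exp M (obs {..0}) (loss u) x\<bar>) x) \<longlonglongrightarrow> 0"
  shows "AE x in M. (\<lambda>N. avg_loss M T l N u_opt x) \<longlonglongrightarrow> optimal_loss M T \<Y> D l"
    and "admissible M T \<Y> D u \<Longrightarrow>
      AE x in M. 0 \<le> liminf (\<lambda>N. ereal (avg_loss M T l N u x - avg_loss M T l N u_opt x))"
proof -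
  note [measurable] = cond_exp_measurable
  let ?E = "\<lambda>u k. cond_exp M (obs {..0}) (loss (recentred u k))"
  define J where "J = (\<lambda>x. real_of_ereal (ess_inf_loss x))"
  have [measurable]: "J \<in> borel_measurable M" unfolding J_def by measurable
  have adm: "admissible M T \<Y> D u_opt" using opt by (simp add: mean_optimal_def)
  have J_int_eq: "optimal_loss M T \<Y> D l = (\<integral>x. J x \<partial>M)"
    by (simp add: optimal_loss_def J_def ess_inf_loss_def)
  have "\<D>\<^sub>0 \<noteq> {}" using recentred_decisions_upto[OF adm] by blast
  from ess_inf_loss_bound[OF this]
  have J: "AE x in M. ereal (J x) = ess_inf_loss x" "AE x in M. \<bar>J x\<bar> \<le> cond_exp M (obs {..0}) \<Lambda> x"
    by (auto simp: J_def)
  have \<Lambda>0: "integrable M (cond_exp M (obs {..0}) \<Lambda>)"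
    by (intro cond_exp_integrable obs_sets \<Lambda>_integrable)
  have J_int: "integrable M J"
  proof (rule Bochner_Integration.integrable_bound[OF \<Lambda>0])
    show "AE x in M. norm (J x) \<le> norm (cond_exp M (obs {..0}) \<Lambda> x)"
      using J(2) by eventually_elim simp
  qed simp
  from birkhoff_ergodic_theorem[OF J_int]
  have J_avg: "AE x in M. (\<lambda>N. cesaro (\<lambda>_. J) N x) \<longlonglongrightarrow> optimal_loss M T \<Y> D l"
    by (simp add: J_int_eq)
  have "AE x in M. (\<lambda>k. ?E u_opt k x) \<longlonglongrightarrow> J x"
    unfolding J_def
  proof (rule near_optimal_loss_tendsto)
    show "recentred u_opt k \<in> \<D>\<^sub>0" for k by (rule recentred_decisions_upto[OF adm])
    show "AE x in M. limsup (\<lambda>k. ereal (?E u_opt k x)) \<le> ereal (cond_exp M (obs {..0}) (loss w) x)"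
      if "w \<in> \<D>\<^sub>0" for w
    proof (rule Limsup_loss_le[OF _ _ conv that])
      show "recentred u_opt k \<in> \<D> (- int k) 0" if "k \<ge> 1" for k
        using recentred_decisions[OF adm, of k] that by (simp add: max_def)
    qed (rule recentred_mean_optimal[OF opt])
  qed
  then have gap: "AE x in M. (\<lambda>k. ?E u_opt k x - J x) \<longlonglongrightarrow> 0"
    by eventually_elim (rule LIM_zero)
  have "AE x in M. (\<lambda>N. cesaro (\<lambda>k x. ?E u_opt k x - J x) N x) \<longlonglongrightarrow> 0"
  proof (rule maker_ergodic_theorem[OF _ _ _ gap])
    show "integrable M (\<lambda>x. 2 * cond_exp M (obs {..0}) \<Lambda> x)" using \<Lambda>0 by simp
    show "AE x in M. \<bar>?E u_opt k x - J x\<bar> \<le> 2 * cond_exp M (obs {..0}) \<Lambda> x" for k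
      using J(2) cond_exp_loss_bound[OF obs_sets decisions_upto_measurable[OF recentred_decisions_upto[OF adm]], of "{..0}" k]
      by eventually_elim linarith
  qed measurable
  with law[OF adm] J_avg AE_space
  show opt_avg: "AE x in M. (\<lambda>N. avg_loss M T l N u_opt x) \<longlonglongrightarrow> optimal_loss M T \<Y> D l"
  proof eventually_elim
    case (elim x)
    \<comment> \<open>The first two averages tend to \<open>0\<close> by the strong law and by
      Maker's theorem, the third tends to the optimal loss by Birkhoff's theorem.\<close>
    have "(\<lambda>N. cesaro (\<lambda>k x. loss (recentred u_opt k) x - ?E u_opt k x) N x
        + cesaro (\<lambda>k x. ?E u_opt k x - J x) N x + cesaro (\<lambda>_. J) N x)
      \<longlonglongrightarrow> 0 + 0 + optimal_loss M T \<Y> D l"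
      by (intro tendsto_add elim)
    then show ?case
      by (simp add: avg_loss_eq_cesaro[OF elim(3)] cesaro_diff)
  qed
  assume u: "admissible M T \<Y> D u"
  have "AE x in M. J x \<le> ?E u k x" for k
    using J(1) ess_inf_loss_lower[OF recentred_decisions_upto[OF u], of k]
  proof eventually_elim
    case (elim x)
    then have "ereal (J x) \<le> ereal (?E u k x)" by simp
    then show ?case by simp
  qed
  from AE_funpow[OF this]
  have "AE x in M. \<forall>k. J ((T ^^ k) x) \<le> ?E u k ((T ^^ k) x)"
    by (simp add: AE_all_countable)
  with law[OF u] J_avg opt_avg AE_space
  show "AE x in M. 0 \<le> liminf (\<lambda>N. ereal (avg_loss M T l N u x - avg_loss M T l N u_opt x))"
  proof eventually_elim
    case (elim x)
    \<comment> \<open>The lower bound \<open>?b\<close> replaces the conditional expectations for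
      \<open>u\<close> by \<open>J\<close>, which lies below them; it tends to
      \<open>0\<close>.\<close>
    let ?b = "\<lambda>N. cesaro (\<lambda>k x. loss (recentred u k) x - ?E u k x) N x
        + cesaro (\<lambda>_. J) N x - avg_loss M T l N u_opt x"
    have "?b \<longlonglongrightarrow> 0 + optimal_loss M T \<Y> D l - optimal_loss M T \<Y> D l"
      by (intro tendsto_add tendsto_diff elim)
    then have "(\<lambda>N. ereal (?b N)) \<longlonglongrightarrow> ereal 0" by simp
    then have "liminf (\<lambda>N. ereal (?b N)) = ereal 0"
      by (rule lim_imp_Liminf[OF sequentially_bot])
    moreover have "?b N \<le> avg_loss M T l N u x - avg_loss M T l N u_opt x" for N
      using cesaro_mono[of "\<lambda>_. J" x "?E u" N] elim
      by (simp add: avg_loss_eq_cesaro cesaro_diff)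
    ultimately show ?case
      using Liminf_mono[of "\<lambda>N. ereal (?b N)" "\<lambda>N. ereal (avg_loss M T l N u x - avg_loss M T l N u_opt x)" sequentially]
      by (simp add: zero_ereal_def)
  qed
qed

end

theorem corollary2p11:
  fixes M :: "'a measure" and T :: "'a \<Rightarrow> 'a" and \<Y> \<X> :: "'a set set"
    and D :: "'u measure" and l :: "'u \<Rightarrow> 'a \<Rightarrow> real" and \<Lambda> :: "'a \<Rightarrow> real"
    and u_opt :: "nat \<Rightarrow> 'a \<Rightarrow> 'u"
  assumes "prob_space M"
    and "sub_sigma_field M \<Y>"
    and "invertible_measure_preserving M T"
    and "ergodic M T"
    and "(\<lambda>(u, \<omega>). l u \<omega>) \<in> borel_measurable (D \<Otimes>\<^sub>M M)"
    and "integrable M \<Lambda>"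
    and "\<forall>u\<in>space D. \<forall>\<omega>\<in>space M. \<bar>l u \<omega>\<bar> \<le> \<Lambda> \<omega>"
    and "mean_optimal M T \<Y> D l u_opt"
    and "sub_sigma_field M \<X>"
    and "\<X> \<subseteq> shift_field M T (- 1) \<X>"
    and "L1_tendsto_zero M (\<lambda>n. ess_sup M (decisions_upto M T \<Y> D 0) (\<lambda>u \<omega>.
           \<bar>cond_exp M (join_field M (obs_field M T \<Y> {..0}) (shift_field M T (- int n) \<X>))
               (loss_at M T l 0 u) \<omega>
            - loss_at M T l 0 u \<omega>\<bar>))"
    and "L1_tendsto_zero M (\<lambda>n. ess_sup M (decisions_upto M T \<Y> D 0) (\<lambda>u \<omega>.
           \<bar>cond_exp M (join_field M (obs_field M T \<Y> {..0}) (shift_field M T (int n) \<X>))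
               (loss_at M T l 0 u) \<omega>
            - cond_exp M (\<Inter>k\<in>{1::nat..}.
                 join_field M (obs_field M T \<Y> {..0}) (shift_field M T (int k) \<X>))
               (loss_at M T l 0 u) \<omega>\<bar>))"
    and "AE \<omega> in M. (\<lambda>n::nat. ess_sup M (decisions M T \<Y> D (- int n) 0) (\<lambda>u \<omega>.
           \<bar>cond_exp M (obs_field M T \<Y> {- int n..0}) (loss_at M T l 0 u) \<omega>
            - cond_exp M (obs_field M T \<Y> {..0}) (loss_at M T l 0 u) \<omega>\<bar>) \<omega>) \<longlonglongrightarrow> 0"
    and "\<forall>u\<in>decisions_upto M T \<Y> D 0. AE \<omega> in M.
           cond_exp M (obs_field M T \<Y> {..0}) (loss_at M T l 0 u) \<omega>
           = cond_exp M (\<Inter>k\<in>{1::nat..}.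
                 join_field M (obs_field M T \<Y> {..0}) (shift_field M T (int k) \<X>))
               (loss_at M T l 0 u) \<omega>"
  shows "(AE \<omega> in M. (\<lambda>N. avg_loss M T l N u_opt \<omega>) \<longlonglongrightarrow> optimal_loss M T \<Y> D l) \<and>
    (\<forall>u. admissible M T \<Y> D u \<longrightarrow>
       (AE \<omega> in M. 0 \<le> liminf (\<lambda>N. ereal (avg_loss M T l N u \<omega> - avg_loss M T l N u_opt \<omega>))))"
proof -
  interpret prob_space M by fact
  \<comment> \<open>Preservation of the measure of preimages becomes invariance of the image
    measure, the form used in \<open>ergodic_map\<close>.\<close>
  have "distr M M T = M"
  proof (rule measure_eqI)
    fix A assume "A \<in> sets (distr M M T)"
    then show "emeasure (distr M M T) A = emeasure M A"
      using assms(3) by (simp add: invertible_measure_preserving_def emeasure_distr)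
  qed simp
  then interpret decision_problem M T \<Y> D l \<Lambda>
    using assms(2-7)
    by unfold_locales (auto simp: invertible_measure_preserving_def sub_sigma_field_def)
  have X: "\<X> \<subseteq> sets M" using assms(9) by (simp add: sub_sigma_field_def)
  \<comment> \<open>Here \<open>\<R>\<close> is the intersection of the fields
    \<open>H\<^sub>k\<close> over \<open>k \<ge> 1\<close>.\<close>
  have law: "AE x in M. (\<lambda>N. cesaro (\<lambda>k x. loss (recentred u k) x
      - cond_exp M (obs {..0}) (loss (recentred u k)) x) N x) \<longlonglongrightarrow> 0"
    if "admissible M T \<Y> D u" for u
    using assms(14)
    by (intro loss_strong_law[OF X assms(10) assms(11,12)[folded enriched_past_def]]
        recentred_decisions_upto that) (simp add: enriched_past_def)
  show ?thesis
    using mean_optimal_avg_loss[OF assms(8) law assms(13)] by blast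
qed

end
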